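(* Let $\beta_{\rm sr},\beta_{\rm sd},\beta_{\rm rd}$ be nonnegative integers, $n=\max\{\beta_{\rm sr},\beta_{\rm sd},\beta_{\rm rd}\}$, and consider the deterministic half-duplex relay channel with $X_s,X_r\in\mathbb{F}_2^n$, $S_r\in\{0,1\}$, and outputs $$Y_r=\mathbf{S}^{n-\beta_{\rm sr}}X_s(1-S_r),\qquad Y_d=\mathbf{S}^{n-\beta_{\rm sd}}X_s+\mathbf{S}^{n-\beta_{\rm rd}}X_rS_r\quad(\text{over }\mathbb{F}_2).$$ Its capacity is $$C^{\rm(HD)}=\begin{cases}\beta_{\rm sd}+\displaystyle\max_{\gamma\in[0,1]}\min\Big\{(1-\theta^*(\gamma))\log\tfrac{1}{1-\theta^*(\gamma)}+\theta^*(\gamma)\log\tfrac{L-1}{\theta^*(\gamma)},\ \gamma[\beta_{\rm sr}-\beta_{\rm sd}]^+\Big\} & \text{if }\beta_{\rm sr}>\beta_{\rm sd},\ \beta_{\rm rd}>\beta_{\rm sd},\\ \beta_{\rm sd} & \text{otherwise,}\end{cases}$$ where $\theta^*(\gamma)=1-\max\{1/L,\gamma\}$ and $L=2^{[\beta_{\rm rd}-\beta_{\rm sd}]^+}$ (with $0\log(\cdot/0):=0$).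
   Context: $\mathbf{S}$ is the $n\times n$ down-shift matrix over $\mathbb{F}_2$ (ones on the first subdiagonal, zeros elsewhere), so $\mathbf{S}^{n-\beta}X$ delivers the $\beta$ most significant bits of $X$ to the $\beta$ lowest positions. The relay chooses $(X_{r,i},S_{r,i})$ at time $i$ as a (possibly randomized) function of its past outputs $Y_r^{i-1}$; $S_r=0$ means the relay listens, $S_r=1$ means it transmits. The source maps its message to $X_s^N$, the destination decodes from $Y_d^N$; capacity is the supremum of rates (bits per channel use) with vanishing error probability. Logs base 2, $[x]^+=\max\{x,0\}$. *)

theory Defs
  imports "HOL-Probability.Probability"
begin

type_synonym bvec = "nat \<Rightarrow> bool"
  \<comment> \<open>a vector in F_2^n, components indexed 0..n-1 (top to bottom); False = 0, True = 1\<close>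

text \<open>(S^k x) for the n x n down-shift matrix S: (S^k x)_i = x_(i-k) if i \<ge> k, else 0.
  Components at positions \<ge> n are irrelevant and set to 0.\<close>
definition shiftv :: "nat \<Rightarrow> nat \<Rightarrow> bvec \<Rightarrow> bvec" where
  "shiftv n k x = (\<lambda>i. if k \<le> i \<and> i < n then x (i - k) else False)"

text \<open>Relay output Y_r = S^(n-bsr) X_s (1 - S_r); S_r = True means the relay transmits.\<close>
definition relay_out :: "nat \<Rightarrow> nat \<Rightarrow> bvec \<Rightarrow> bool \<Rightarrow> bvec" where
  "relay_out n bsr xs sr = (if sr then (\<lambda>_. False) else shiftv n (n - bsr) xs)"

definition dest_out :: "nat \<Rightarrow> nat \<Rightarrow> nat \<Rightarrow> bvec \<Rightarrow> bvec \<Rightarrow> bool \<Rightarrow> bvec" where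
  "dest_out n bsd brd xs xr sr =
     (\<lambda>i. shiftv n (n - bsd) xs i \<noteq> (sr \<and> shiftv n (n - brd) xr i))"

type_synonym relay_strategy = "nat \<Rightarrow> bvec list \<Rightarrow> (bvec \<times> bool) pmf"
  \<comment> \<open>at time i (0-based) the relay draws (X_r,S_r) from a distribution depending on Y_r^(i-1)\<close>

fun hd_run :: "nat \<Rightarrow> nat \<Rightarrow> nat \<Rightarrow> nat \<Rightarrow> relay_strategy \<Rightarrow> nat \<Rightarrow> bvec list
                 \<Rightarrow> bvec list \<Rightarrow> bvec list pmf" where
  "hd_run n bsr bsd brd rel i yr [] = return_pmf []"
| "hd_run n bsr bsd brd rel i yr (x # xs) =
     bind_pmf (rel i yr) (\<lambda>(xr, sr).
       map_pmf (\<lambda>rest. dest_out n bsd brd x xr sr # rest)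
         (hd_run n bsr bsd brd rel (Suc i) (yr @ [relay_out n bsr x sr]) xs))"

definition err_prob :: "nat \<Rightarrow> nat \<Rightarrow> nat \<Rightarrow> nat \<Rightarrow> nat \<Rightarrow> (nat \<Rightarrow> bvec list)
                         \<Rightarrow> relay_strategy \<Rightarrow> (bvec list \<Rightarrow> nat) \<Rightarrow> real" where
  "err_prob n bsr bsd brd M enc rel dec =
     (\<Sum>m<M. measure_pmf.prob (hd_run n bsr bsd brd rel 0 [] (enc m)) {y. dec y \<noteq> m}) / real M"

definition hd_achievable :: "nat \<Rightarrow> nat \<Rightarrow> nat \<Rightarrow> real \<Rightarrow> bool" where
  "hd_achievable bsr bsd brd R \<longleftrightarrow>
     (let n = max bsr (max bsd brd) in
      \<exists>enc :: nat \<Rightarrow> nat \<Rightarrow> bvec list. \<exists>rel :: nat \<Rightarrow> relay_strategy.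
      \<exists>dec :: nat \<Rightarrow> bvec list \<Rightarrow> nat.
        (\<forall>N m. length (enc N m) = N) \<and>
        (\<lambda>N. err_prob n bsr bsd brd (nat \<lceil>2 powr (real N * R)\<rceil>) (enc N) (rel N) (dec N))
          \<longlonglongrightarrow> 0)"

definition hd_capacity :: "nat \<Rightarrow> nat \<Rightarrow> nat \<Rightarrow> real" where
  "hd_capacity bsr bsd brd = Sup {R. 0 \<le> R \<and> hd_achievable bsr bsd brd R}"

definition xlogy :: "real \<Rightarrow> real \<Rightarrow> real" where
  "xlogy th a = (if th = 0 then 0 else th * log 2 (a / th))"

definition theta_star :: "real \<Rightarrow> real \<Rightarrow> real" where
  "theta_star L \<gamma> = 1 - max (1 / L) \<gamma>"

definition cap_formula :: "nat \<Rightarrow> nat \<Rightarrow> nat \<Rightarrow> real" where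
  "cap_formula bsr bsd brd =
     (if bsr > bsd \<and> brd > bsd then
        let L = (2::real) ^ (brd - bsd) in
        real bsd + (SUP \<gamma>\<in>{0..1::real}.
          min ((1 - theta_star L \<gamma>) * log 2 (1 / (1 - theta_star L \<gamma>))
                 + xlogy (theta_star L \<gamma>) (L - 1))
              (\<gamma> * real (bsr - bsd)))
      else real bsd)"

end

theory Submission
  imports Defs "HOL-Real_Asymp.Real_Asymp"
begin

text \<open>
  Converse. Fix a code of length \<open>N\<close> and a number \<open>k\<close> of listening slots. Two counting arguments bound
  the expected number of correctly decoded messages for which the relay listens exactly \<open>k\<close> times.
  The destination sees a word with at least \<open>k\<close> letters whose top \<open>brd - bsd\<close> bits vanish, and weighting
  letters by the maximising distribution shows that there are at most \<open>2 powr (N (bsd + h(k/N)))\<close> such words.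
  On the other hand each listening slot splits the messages into at most \<open>2 ^ max bsr bsd\<close> classes and each
  transmitting slot into at most \<open>2 ^ bsd\<close>, which gives \<open>2 ^ (N bsd + k [bsr - bsd]^+)\<close>. Summing over \<open>k\<close>,
  at most \<open>(N + 1) 2 powr (N C)\<close> messages are decoded correctly, so no rate above \<open>C\<close> is achievable.

  Achievability. The bits \<open>0..<bsd\<close> of the source always reach the destination uncorrupted if the relay
  uses only its top \<open>brd - bsd\<close> bits. The relay sends words over \<open>2 ^ (brd - bsd)\<close> letters of block length
  \<open>B\<close> with exactly \<open>k\<close> zero letters: it listens at the zeros, so in each block the source can pass it
  \<open>k (bsr - bsd)\<close> further bits, which select the word of the next block. This block Markov scheme makes
  no errors, and the number of such words is \<open>2 powr (B h(k/B))\<close> up to a factor \<open>B + 1\<close>.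
\<close>

section \<open>Converse\<close>

lemma card_bvec_supported:
  assumes "finite S"
  shows "card {y :: bvec. \<forall>i. y i \<longrightarrow> i \<in> S} = 2 ^ card S"
    and "finite {y :: bvec. \<forall>i. y i \<longrightarrow> i \<in> S}"
proof -
  have eq: "{y :: bvec. \<forall>i. y i \<longrightarrow> i \<in> S} = (\<lambda>T i. i \<in> T) ` Pow S"
  proof (intro equalityI subsetI)
    fix y :: bvec assume "y \<in> {y. \<forall>i. y i \<longrightarrow> i \<in> S}"
    then have "y = (\<lambda>i. i \<in> Collect y)" "Collect y \<in> Pow S" by auto
    then show "y \<in> (\<lambda>T i. i \<in> T) ` Pow S" by blast
  qed auto
  have "inj_on (\<lambda>T i. i \<in> T) (Pow S)"
    by (rule inj_onI) (metis Collect_mem_eq)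
  then show "card {y :: bvec. \<forall>i. y i \<longrightarrow> i \<in> S} = 2 ^ card S"
    unfolding eq using assms by (simp add: card_image card_Pow)
  show "finite {y :: bvec. \<forall>i. y i \<longrightarrow> i \<in> S}"
    unfolding eq using assms by simp
qed

lemma card_image_prefix_determined:
  fixes f :: "bvec \<Rightarrow> 'a"
  assumes "\<And>x y. (\<And>j. j < d \<Longrightarrow> x j = y j) \<Longrightarrow> f x = f y"
  shows "card (f ` S) \<le> 2 ^ d"
proof -
  have sub: "f ` S \<subseteq> (\<lambda>T. f (\<lambda>j. j \<in> T)) ` Pow {..<d}"
  proof
    fix z assume "z \<in> f ` S"
    then obtain x where "z = f x" by auto
    also have "\<dots> = f (\<lambda>j. j \<in> {j. j < d \<and> x j})"
      by (rule assms) auto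
    finally show "z \<in> (\<lambda>T. f (\<lambda>j. j \<in> T)) ` Pow {..<d}" by blast
  qed
  have "card (f ` S) \<le> card ((\<lambda>T. f (\<lambda>j. j \<in> T)) ` Pow {..<d})"
    by (rule card_mono[OF _ sub]) simp
  also have "\<dots> \<le> card (Pow {..<d})" by (rule card_image_le) simp
  finally show "card (f ` S) \<le> 2 ^ d" by (simp add: card_Pow)
qed

text \<open>The destination output need not reveal whether the relay listened. Recording the state
  beside each output turns the number of listening slots into an event that can be split
  over.\<close>

fun hd_trace :: "nat \<Rightarrow> nat \<Rightarrow> nat \<Rightarrow> nat \<Rightarrow> relay_strategy \<Rightarrow> nat \<Rightarrow> bvec list
                   \<Rightarrow> bvec list \<Rightarrow> (bvec \<times> bool) list pmf" where
  "hd_trace n bsr bsd brd rel i yr [] = return_pmf []"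
| "hd_trace n bsr bsd brd rel i yr (x # xs) =
     bind_pmf (rel i yr) (\<lambda>(xr, sr).
       map_pmf (\<lambda>rest. (dest_out n bsd brd x xr sr, sr) # rest)
         (hd_trace n bsr bsd brd rel (Suc i) (yr @ [relay_out n bsr x sr]) xs))"

definition listens :: "(bvec \<times> bool) list \<Rightarrow> nat" where
  "listens zs = length (filter (\<lambda>z. \<not> snd z) zs)"

lemma listens_simps [simp]:
  "listens [] = 0"
  "listens ((y, True) # zs) = listens zs"
  "listens ((y, False) # zs) = Suc (listens zs)"
  by (simp_all add: listens_def)

lemma map_fst_hd_trace:
  "map_pmf (map fst) (hd_trace n bsr bsd brd rel i yr xs) = hd_run n bsr bsd brd rel i yr xs"
proof (induction xs arbitrary: i yr)
  case (Cons x xs)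
  show ?case
    unfolding hd_trace.simps hd_run.simps map_bind_pmf Cons.IH[symmetric]
    by (intro bind_pmf_cong refl) (simp add: split_beta map_pmf_comp)
qed simp

lemma listens_le_length:
  "zs \<in> set_pmf (hd_trace n bsr bsd brd rel i yr xs) \<Longrightarrow> listens zs \<le> length xs"
proof (induction xs arbitrary: i yr zs)
  case (Cons x xs)
  then obtain xr sr zs' where
    z: "zs = (dest_out n bsd brd x xr sr, sr) # zs'"
    and "zs' \<in> set_pmf (hd_trace n bsr bsd brd rel (Suc i) (yr @ [relay_out n bsr x sr]) xs)"
    by (auto simp: split_beta)
  with Cons.IH have "listens zs' \<le> length xs" by blast
  with z show ?case by (cases sr) auto
qed simp

text \<open>A shift by \<open>n - b\<close> keeps only the first \<open>b\<close> components. A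
  transmitting relay receives a constant, so only \<open>bsd\<close> source bits matter; a listening
  one brings in \<open>bsr\<close> bits, and with truncated subtraction
  \<open>bsd + (bsr - bsd)\<close> is \<open>max bsd bsr\<close>.\<close>

lemma relay_dest_key_bound:
  fixes x :: "'m \<Rightarrow> bvec" and brd :: nat
  assumes "bsr \<le> n" "bsd \<le> n"
  defines "key \<equiv> \<lambda>sr xr m. (relay_out n bsr (x m) sr, dest_out n bsd brd (x m) xr sr)"
  shows "card (key True xr ` A) \<le> 2 ^ bsd"
    and "card (key False xr ` A) \<le> 2 ^ (bsd + (bsr - bsd))"
proof -
  have cut: "shiftv n (n - b) u = shiftv n (n - b) v"
    if "b \<le> n" "\<And>j. j < b \<Longrightarrow> u j = v j" for b and u v :: bvec
    using that by (auto simp: shiftv_def fun_eq_iff)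
  define f where "f sr u = (relay_out n bsr u sr, dest_out n bsd brd u xr sr)" for sr u
  have key: "key sr xr ` A = f sr ` x ` A" for sr
    by (auto simp: key_def f_def)
  show "card (key True xr ` A) \<le> 2 ^ bsd"
    unfolding key
  proof (rule card_image_prefix_determined)
    fix u v :: bvec assume "\<And>j. j < bsd \<Longrightarrow> u j = v j"
    then have "shiftv n (n - bsd) u = shiftv n (n - bsd) v"
      using assms by (intro cut) auto
    then show "f True u = f True v" by (simp add: f_def relay_out_def dest_out_def)
  qed
  show "card (key False xr ` A) \<le> 2 ^ (bsd + (bsr - bsd))"
    unfolding key
  proof (rule card_image_prefix_determined)
    fix u v :: bvec assume eq: "\<And>j. j < bsd + (bsr - bsd) \<Longrightarrow> u j = v j"
    have "shiftv n (n - bsd) u = shiftv n (n - bsd) v" "shiftv n (n - bsr) u = shiftv n (n - bsr) v"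
      using assms by (auto intro!: cut eq)
    then show "f False u = f False v" by (simp add: f_def relay_out_def dest_out_def)
  qed
qed

lemma prob_bind_pmf:
  "measure_pmf.prob (bind_pmf p f) X = measure_pmf.expectation p (\<lambda>x. measure_pmf.prob (f x) X)"
  unfolding measure_pmf_bind
  by (rule measure_pmf.measure_bind[where N = "count_space UNIV"])
    (auto simp: measure_pmf_in_subprob_algebra)

text \<open>The decoder may be an arbitrary function of the trace because the induction conditions on the first
  letter; messages with equal first outputs at relay and destination stay together.\<close>

lemma relay_cut_bound:
  assumes "bsr \<le> n" "bsd \<le> n" "finite A" "\<And>m. m \<in> A \<Longrightarrow> length (enc m) = N"
  shows "(\<Sum>m\<in>A. measure_pmf.prob (hd_trace n bsr bsd brd rel i yr (enc m))
             {zs. dec zs = m \<and> listens zs = k}) \<le> 2 ^ (N * bsd + k * (bsr - bsd))"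
  using assms(3,4)
proof (induction N arbitrary: A enc dec i yr k)
  case 0
  have "(\<Sum>m\<in>A. measure_pmf.prob (hd_trace n bsr bsd brd rel i yr (enc m))
             {zs. dec zs = m \<and> listens zs = k}) \<le> (\<Sum>m\<in>A. if m = dec [] then 1 else 0)"
    using 0 by (intro sum_mono) auto
  also have "\<dots> \<le> 1" using 0 by simp
  also have "(1::real) \<le> 2 ^ (0 * bsd + k * (bsr - bsd))" by simp
  finally show ?case .
next
  case (Suc N)
  \<comment> \<open>The first relay output \<open>yr'\<close> is an argument separate from the
    message, so that it can be frozen on a class of messages sharing it.\<close>
  define P where "P yr' m D = measure_pmf.prob
     (hd_trace n bsr bsd brd rel (Suc i) (yr @ [yr']) (tl (enc m))) D" for yr' m D
  define ro where "ro sr m = relay_out n bsr (hd (enc m)) sr" for sr m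
  define de where "de xr sr m = dest_out n bsd brd (hd (enc m)) xr sr" for xr sr m
  define key where "key sr xr m = (ro sr m, de xr sr m)" for sr xr m
  define E where "E sr y m = {zs. dec ((y, sr) # zs) = m \<and> listens ((y, sr) # zs) = k}"
    for sr y m
  define G where "G = (\<lambda>(xr, sr). \<Sum>m\<in>A. P (ro sr m) m (E sr (de xr sr m) m))"
  have step: "measure_pmf.prob (hd_trace n bsr bsd brd rel i yr (enc m))
                {zs. dec zs = m \<and> listens zs = k}
              = measure_pmf.expectation (rel i yr)
                  (\<lambda>(xr, sr). P (ro sr m) m (E sr (de xr sr m) m))" if "m \<in> A" for m
  proof -
    obtain x xs where "enc m = x # xs" using Suc.prems(2)[OF \<open>m \<in> A\<close>] by (cases "enc m") auto
    then show ?thesis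
      by (simp add: prob_bind_pmf case_prod_unfold P_def E_def ro_def de_def vimage_def)
  qed
  have integ: "integrable (measure_pmf (rel i yr))
                  (\<lambda>(xr, sr). P (ro sr m) m (E sr (de xr sr m) m))" for m
    by (rule measure_pmf.integrable_const_bound[where B = 1]) (auto simp: P_def case_prod_unfold)
  have "(\<Sum>m\<in>A. measure_pmf.prob (hd_trace n bsr bsd brd rel i yr (enc m))
             {zs. dec zs = m \<and> listens zs = k})
        = (\<Sum>m\<in>A. measure_pmf.expectation (rel i yr)
                  (\<lambda>(xr, sr). P (ro sr m) m (E sr (de xr sr m) m)))"
    by (rule sum.cong) (auto simp: step)
  also have "\<dots> = measure_pmf.expectation (rel i yr) G"
    using integ unfolding G_def case_prod_unfold
    by (intro Bochner_Integration.integral_sum[symmetric]) auto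
  also have "\<dots> \<le> 2 ^ (Suc N * bsd + k * (bsr - bsd))"
  proof (rule measure_pmf.integral_le_const)
    show "integrable (measure_pmf (rel i yr)) G"
      using integ unfolding G_def case_prod_unfold
      by (intro Bochner_Integration.integrable_sum) auto
    have "G (xr, sr) \<le> 2 ^ (Suc N * bsd + k * (bsr - bsd))" for xr sr
    proof -
      \<comment> \<open>On a fibre of \<open>key\<close> all messages share the relay's history and
        the first letter at the destination. The sum over the fibre then has the shape of the
        induction hypothesis, with \<open>dec\<close> applied after prepending that letter.\<close>
      have grp: "(\<Sum>m\<in>{m \<in> A. key sr xr m = \<kappa>}. P (ro sr m) m (E sr (de xr sr m) m)) \<le> c"
        if "\<And>A'. A' \<subseteq> A \<Longrightarrow> (\<Sum>m\<in>A'. P (fst \<kappa>) m (E sr (snd \<kappa>) m)) \<le> c" for \<kappa> c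
      proof -
        have "(\<Sum>m\<in>{m \<in> A. key sr xr m = \<kappa>}. P (ro sr m) m (E sr (de xr sr m) m))
            = (\<Sum>m\<in>{m \<in> A. key sr xr m = \<kappa>}. P (fst \<kappa>) m (E sr (snd \<kappa>) m))"
          by (rule sum.cong) (auto simp: key_def)
        then show ?thesis using that[of "{m \<in> A. key sr xr m = \<kappa>}"] by auto
      qed
      have G: "G (xr, sr) = (\<Sum>\<kappa>\<in>key sr xr ` A. \<Sum>m\<in>{m \<in> A. key sr xr m = \<kappa>}.
                      P (ro sr m) m (E sr (de xr sr m) m))"
        unfolding G_def using sum.image_gen[OF Suc.prems(1)] by simp
      \<comment> \<open>Number of fibres times the bound for a single fibre.\<close>
      have tot: "G (xr, sr) \<le> 2 ^ a * 2 ^ b"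
        if "card (key sr xr ` A) \<le> 2 ^ a"
          "\<And>A' \<kappa>. A' \<subseteq> A \<Longrightarrow> (\<Sum>m\<in>A'. P (fst \<kappa>) m (E sr (snd \<kappa>) m)) \<le> 2 ^ b" for a b
      proof -
        have "G (xr, sr) \<le> real (card (key sr xr ` A)) * 2 ^ b"
          unfolding G by (rule sum_bounded_above) (intro grp that(2))
        also have "\<dots> \<le> 2 ^ a * 2 ^ b"
          using that(1) by (intro mult_right_mono) (auto simp: numeral_power_le_of_nat_cancel_iff)
        finally show ?thesis .
      qed
      have lenA: "\<And>m. m \<in> A' \<Longrightarrow> length (tl (enc m)) = N" if "A' \<subseteq> A" for A'
        using that Suc.prems(2) by auto
      have finA: "finite A'" if "A' \<subseteq> A" for A'
        using that Suc.prems(1) finite_subset by blast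
      show ?thesis
      proof (cases sr)
        case True
        have "(\<Sum>m\<in>A'. P (fst \<kappa>) m (E sr (snd \<kappa>) m)) \<le> 2 ^ (N * bsd + k * (bsr - bsd))"
          if "A' \<subseteq> A" for A' \<kappa>
          using Suc.IH[where i = "Suc i" and yr = "yr @ [fst \<kappa>]" and k = k and
              dec = "\<lambda>zs. dec ((snd \<kappa>, sr) # zs)", OF finA[OF that] lenA[OF that]] True
          by (simp add: P_def E_def)
        moreover have "card (key sr xr ` A) \<le> 2 ^ bsd"
          using relay_dest_key_bound(1)[OF assms(1,2), of "\<lambda>m. hd (enc m)" brd xr A] True
          by (simp add: key_def ro_def de_def)
        ultimately have "G (xr, sr) \<le> 2 ^ bsd * 2 ^ (N * bsd + k * (bsr - bsd))"
          by (rule tot[rotated])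
        then show ?thesis by (simp add: power_add mult_ac)
      next
        case False
        show ?thesis
        proof (cases k)
          case 0
          then have "G (xr, sr) = 0" using False by (simp add: G_def E_def P_def)
          then show ?thesis by simp
        next
          case (Suc k')
          have "(\<Sum>m\<in>A'. P (fst \<kappa>) m (E sr (snd \<kappa>) m)) \<le> 2 ^ (N * bsd + k' * (bsr - bsd))"
            if "A' \<subseteq> A" for A' \<kappa>
            using Suc.IH[where i = "Suc i" and yr = "yr @ [fst \<kappa>]" and k = k' and
              dec = "\<lambda>zs. dec ((snd \<kappa>, sr) # zs)", OF finA[OF that] lenA[OF that]] False Suc
            by (simp add: P_def E_def)
          moreover have "card (key sr xr ` A) \<le> 2 ^ (bsd + (bsr - bsd))"
            using relay_dest_key_bound(2)[OF assms(1,2), of "\<lambda>m. hd (enc m)" brd xr A] False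
            by (simp add: key_def ro_def de_def)
          ultimately have "G (xr, sr) \<le> 2 ^ (bsd + (bsr - bsd)) * 2 ^ (N * bsd + k' * (bsr - bsd))"
            by (rule tot[rotated])
          then show ?thesis using Suc by (simp add: power_add mult_ac)
        qed
      qed
    qed
    then show "AE x in measure_pmf (rel i yr). G x \<le> 2 ^ (Suc N * bsd + k * (bsr - bsd))"
      by (intro AE_pmfI) (metis surj_pair)
  qed
  finally show ?case .
qed

section \<open>Weighted counting of words, and the destination cut\<close>

lemma sum_prod_list_words:
  fixes w :: "'a \<Rightarrow> real"
  assumes "finite D"
  shows "(\<Sum>ys\<in>{ys. set ys \<subseteq> D \<and> length ys = N}. prod_list (map w ys)) = (\<Sum>y\<in>D. w y) ^ N"
proof (induction N)
  case 0
  have "{ys. set ys \<subseteq> D \<and> length ys = 0} = {[]}" by auto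
  then show ?case by simp
next
  case (Suc N)
  have "(\<Sum>ys\<in>{ys. set ys \<subseteq> D \<and> length ys = Suc N}. prod_list (map w ys))
      = (\<Sum>(ys, y)\<in>{ys. set ys \<subseteq> D \<and> length ys = N} \<times> D. prod_list (map w (y # ys)))"
    unfolding lists_length_Suc_eq
    by (subst sum.reindex) (auto simp: inj_on_def split_beta intro!: sum.cong)
  also have "\<dots> = (\<Sum>ys\<in>{ys. set ys \<subseteq> D \<and> length ys = N}. \<Sum>y\<in>D. w y * prod_list (map w ys))"
    by (subst sum.cartesian_product[symmetric]) simp
  also have "\<dots> = (\<Sum>y\<in>D. w y) * (\<Sum>ys\<in>{ys. set ys \<subseteq> D \<and> length ys = N}. prod_list (map w ys))"
    by (simp add: sum_distrib_right sum_distrib_left)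
  finally show ?case using Suc by simp
qed

text \<open>Since \<open>q \<le> p\<close>, letters of \<open>Z\<close> beyond the first
  \<open>k\<close> can only raise the product.\<close>

lemma prod_list_two_weights:
  fixes p q :: real
  assumes "0 \<le> q" "q \<le> p" "k \<le> length (filter (\<lambda>y. y \<in> Z) ys)"
  shows "p ^ k * q ^ (length ys - k) \<le> prod_list (map (\<lambda>y. if y \<in> Z then p else q) ys)"
proof -
  define j where "j = length (filter (\<lambda>y. y \<in> Z) ys)"
  have j: "j \<le> length ys" "k \<le> j" using assms(3) by (auto simp: j_def)
  have pr: "prod_list (map (\<lambda>y. if y \<in> Z then p else q) ys) = p ^ j * q ^ (length ys - j)"
    unfolding j_def
  proof (induction ys)
    case (Cons y ys)
    have "length (filter (\<lambda>y. y \<in> Z) ys) \<le> length ys" by simp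
    then show ?case using Cons by (simp add: Suc_diff_le)
  qed simp
  have "p ^ k * q ^ (length ys - k) = p ^ k * (q ^ (j - k) * q ^ (length ys - j))"
    using j by (simp add: power_add[symmetric])
  also have "\<dots> \<le> p ^ k * (p ^ (j - k) * q ^ (length ys - j))"
    using assms by (intro mult_left_mono mult_right_mono power_mono) auto
  also have "\<dots> = p ^ j * q ^ (length ys - j)"
    using j by (simp add: power_add[symmetric] mult.assoc[symmetric])
  finally show ?thesis using pr by simp
qed

text \<open>The weights \<open>p\<close> on \<open>Z\<close> and \<open>q\<close> elsewhere total at
  most 1 on \<open>D\<close>, so all words of length \<open>N\<close> together weigh at most 1,
  while each counted word weighs at least \<open>p ^ k * q ^ (N - k)\<close>.\<close>

lemma card_words_many_in_le:
  fixes p q :: real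
  assumes "finite D" "Z \<subseteq> D" "0 \<le> q" "q \<le> p"
    and total: "card Z * p + card (D - Z) * q \<le> 1"
  shows "card {ys. set ys \<subseteq> D \<and> length ys = N \<and> k \<le> length (filter (\<lambda>y. y \<in> Z) ys)}
           * (p ^ k * q ^ (N - k)) \<le> 1"
proof -
  define w where "w y = (if y \<in> Z then p else q)" for y
  let ?Y = "{ys. set ys \<subseteq> D \<and> length ys = N \<and> k \<le> length (filter (\<lambda>y. y \<in> Z) ys)}"
  have "card ?Y * (p ^ k * q ^ (N - k)) = (\<Sum>ys\<in>?Y. p ^ k * q ^ (length ys - k))"
    by simp
  also have "\<dots> \<le> (\<Sum>ys\<in>?Y. prod_list (map w ys))"
    unfolding w_def using assms by (intro sum_mono prod_list_two_weights) auto
  also have "\<dots> \<le> (\<Sum>ys\<in>{ys. set ys \<subseteq> D \<and> length ys = N}. prod_list (map w ys))"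
    using assms by (intro sum_mono2 finite_lists_length_eq)
      (auto intro!: prod_list_nonneg simp: w_def)
  also have "\<dots> = (\<Sum>y\<in>D. w y) ^ N"
    by (rule sum_prod_list_words) fact
  also have "\<dots> \<le> 1"
  proof (rule power_le_one)
    show "0 \<le> (\<Sum>y\<in>D. w y)" using assms by (intro sum_nonneg) (auto simp: w_def)
    have "(\<Sum>y\<in>D. w y) = (\<Sum>y\<in>D - Z. w y) + (\<Sum>y\<in>Z. w y)"
      using assms by (intro sum.subset_diff) auto
    also have "(\<Sum>y\<in>D - Z. w y) = (\<Sum>y\<in>D - Z. q)" by (rule sum.cong) (auto simp: w_def)
    also have "(\<Sum>y\<in>Z. w y) = (\<Sum>y\<in>Z. p)" by (rule sum.cong) (auto simp: w_def)
    finally show "(\<Sum>y\<in>D. w y) \<le> 1" using total by simp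
  qed
  finally show ?thesis .
qed

text \<open>For \<open>\<gamma>\<close> in \<open>{0..1}\<close> and \<open>L\<close> at least 2,
  this is the greatest entropy of a distribution on \<open>L\<close> letters that gives one fixed
  letter probability at least \<open>\<gamma>\<close>: the remaining mass is spread uniformly over
  the other \<open>L - 1\<close> letters.\<close>

definition top_entropy :: "real \<Rightarrow> real \<Rightarrow> real" where
  "top_entropy L \<gamma> = (1 - theta_star L \<gamma>) * log 2 (1 / (1 - theta_star L \<gamma>))
                 + xlogy (theta_star L \<gamma>) (L - 1)"

text \<open>At \<open>\<gamma> \<le> 1 / L\<close> the maximising distribution is uniform and both sides are \<open>L ^ (- N)\<close>.\<close>

lemma type_weight_eq:
  fixes L :: real
  assumes "2 \<le> L" "k \<le> N" "0 < N"
  defines "g \<equiv> max (1 / L) (real k / real N)"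
  shows "g ^ k * ((1 - g) / (L - 1)) ^ (N - k) = 2 powr (- (real N * top_entropy L (real k / real N)))"
proof -
  have te: "top_entropy L (real k / real N) = g * log 2 (1 / g) + xlogy (1 - g) (L - 1)"
    by (simp add: top_entropy_def theta_star_def g_def)
  show ?thesis
  proof (cases "real k / real N \<le> 1 / L")
    case True
    then have g: "g = 1 / L" by (simp add: g_def)
    then have q: "(1 - g) / (L - 1) = 1 / L" using assms(1) by (simp add: field_simps)
    have "(L - 1) / (1 - g) = L" unfolding g using assms(1) by (simp add: field_simps)
    moreover have "1 - g \<noteq> 0" using assms(1) g by simp
    ultimately have "top_entropy L (real k / real N) = g * log 2 L + (1 - g) * log 2 L"
      unfolding te using g by (simp add: xlogy_def)
    then have te': "top_entropy L (real k / real N) = log 2 L" by (simp add: algebra_simps)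
    have "g ^ k * ((1 - g) / (L - 1)) ^ (N - k) = (1 / L) ^ N"
      unfolding q using assms(2) by (simp add: g power_add[symmetric])
    also have "\<dots> = 2 powr (- (real N * log 2 L))"
    proof -
      have "2 powr (- (real N * log 2 L)) = 2 powr (log 2 L * (- real N))" by (simp add: mult.commute)
      also have "\<dots> = (2 powr log 2 L) powr (- real N)" by (rule powr_powr[symmetric])
      also have "\<dots> = L powr (- real N)" using assms(1) by simp
      also have "\<dots> = (1 / L) ^ N" using assms(1)
        by (simp add: powr_minus powr_realpow divide_inverse power_inverse)
      finally show ?thesis by simp
    qed
    finally show ?thesis using te' by simp
  next
    case False
    then have g: "g = real k / real N" by (simp add: g_def)
    with False have gpos: "0 < g" using assms(1) 
      by (metis less_max_iff_disj g_def divide_pos_pos less_le_trans zero_less_numeral zero_less_one)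
    then have k: "0 < k" using g by (cases k) auto
    have gN: "real N * g = real k" using g assms(3) by simp
    show ?thesis
    \<comment> \<open>For \<open>k = N\<close> the second weight is 0 and cannot be written as a
      power of 2, but its exponent \<open>N - k\<close> is 0 and \<open>xlogy\<close> vanishes as
      well.\<close>
    proof (cases "k = N")
      case True
      then have "g = 1" using g assms(3) by simp
      then show ?thesis using True te by (simp add: xlogy_def)
    next
      case False
      then have "k < N" using assms(2) by simp
      then have g1: "g < 1" using g by simp
      have q0: "0 < (1 - g) / (L - 1)" using g1 assms(1) by simp
      have "g ^ k * ((1 - g) / (L - 1)) ^ (N - k)
           = (2 powr log 2 g) powr real k * (2 powr log 2 ((1 - g) / (L - 1))) powr real (N - k)"
        using q0 gpos by (simp add: powr_realpow)
      also have "\<dots> = 2 powr (real k * log 2 g + real (N - k) * log 2 ((1 - g) / (L - 1)))"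
        by (simp add: powr_powr powr_add mult.commute)
      also have "real k * log 2 g + real (N - k) * log 2 ((1 - g) / (L - 1))
           = - (real N * (g * log 2 (1 / g) + (1 - g) * log 2 ((L - 1) / (1 - g))))"
      proof -
        have "real (N - k) = real N * (1 - g)" using gN \<open>k < N\<close> by (simp add: algebra_simps)
        moreover have "log 2 (1 / g) = - log 2 g" using gpos by (simp add: log_divide)
        moreover have "log 2 ((L - 1) / (1 - g)) = - log 2 ((1 - g) / (L - 1))"
          using g1 assms(1) by (simp add: log_divide)
        ultimately show ?thesis using gN[symmetric] by (simp add: algebra_simps)
      qed
      finally show ?thesis using te g1 by (simp add: xlogy_def)
    qed
  qed
qed

definition dest_range :: "nat \<Rightarrow> nat \<Rightarrow> bvec set" where
  "dest_range n b = {y. \<forall>i. y i \<longrightarrow> i \<in> {n - b..<n}}"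

lemma dest_range_mono: "b \<le> b' \<Longrightarrow> dest_range n b \<subseteq> dest_range n b'"
  by (fastforce simp: dest_range_def)

lemma card_dest_range: "b \<le> n \<Longrightarrow> card (dest_range n b) = 2 ^ b"
  and finite_dest_range: "finite (dest_range n b)"
  using card_bvec_supported[of "{n - b..<n}"] by (simp_all add: dest_range_def)

lemma dest_out_in_range: "dest_out n bsd brd x xr sr \<in> dest_range n (max bsd brd)"
  by (auto simp: dest_out_def shiftv_def dest_range_def)

lemma dest_out_in_range_listen: "dest_out n bsd brd x xr False \<in> dest_range n bsd"
  by (auto simp: dest_out_def shiftv_def dest_range_def)

text \<open>"At least \<open>k\<close>" instead of "exactly \<open>k\<close>", because a
  transmitting relay may also produce a letter of \<open>dest_range n bsd\<close>, for instance by
  sending zeros.\<close>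

definition dest_words :: "nat \<Rightarrow> nat \<Rightarrow> nat \<Rightarrow> nat \<Rightarrow> nat \<Rightarrow> bvec list set" where
  "dest_words n bsd brd N k = {ys. set ys \<subseteq> dest_range n (max bsd brd) \<and> length ys = N \<and>
      k \<le> length (filter (\<lambda>y. y \<in> dest_range n bsd) ys)}"

lemma hd_trace_in_dest_words:
  "zs \<in> set_pmf (hd_trace n bsr bsd brd rel i yr xs)
     \<Longrightarrow> map fst zs \<in> dest_words n bsd brd (length xs) (listens zs)"
proof (induction xs arbitrary: i yr zs)
  case (Cons x xs)
  then obtain xr sr zs' where
    z: "zs = (dest_out n bsd brd x xr sr, sr) # zs'"
    and "zs' \<in> set_pmf (hd_trace n bsr bsd brd rel (Suc i) (yr @ [relay_out n bsr x sr]) xs)"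
    by (auto simp: split_beta)
  with Cons.IH have "map fst zs' \<in> dest_words n bsd brd (length xs) (listens zs')" by blast
  with z show ?case
    using dest_out_in_range dest_out_in_range_listen by (cases sr) (auto simp: dest_words_def)
qed (simp add: dest_words_def)

lemma finite_dest_words: "finite (dest_words n bsd brd N k)"
  by (rule finite_subset[OF _ finite_lists_length_eq[OF finite_dest_range, of n "max bsd brd" N]])
    (auto simp: dest_words_def)

text \<open>The words decoded to different messages form disjoint sets. A message contributes at
  most 1, and 0 if its set is empty, hence never more than the size of its set.\<close>

lemma dest_cut_bound:
  assumes "finite A" "\<And>m. m \<in> A \<Longrightarrow> length (enc m) = N"
  shows "(\<Sum>m\<in>A. measure_pmf.prob (hd_trace n bsr bsd brd rel i yr (enc m))
             {zs. dec (map fst zs) = m \<and> listens zs = k}) \<le> card (dest_words n bsd brd N k)"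
proof -
  define Y where "Y m = {ys \<in> dest_words n bsd brd N k. dec ys = m}" for m
  have finY: "finite (Y m)" for m using finite_dest_words by (simp add: Y_def)
  have "measure_pmf.prob (hd_trace n bsr bsd brd rel i yr (enc m))
             {zs. dec (map fst zs) = m \<and> listens zs = k} \<le> card (Y m)" if "m \<in> A" for m
  proof (cases "Y m = {}")
    case True
    have "zs \<notin> {zs. dec (map fst zs) = m \<and> listens zs = k}"
      if "zs \<in> set_pmf (hd_trace n bsr bsd brd rel i yr (enc m))" for zs
      using hd_trace_in_dest_words[OF that] assms(2)[OF \<open>m \<in> A\<close>] True by (auto simp: Y_def)
    then have "measure_pmf.prob (hd_trace n bsr bsd brd rel i yr (enc m))
             {zs. dec (map fst zs) = m \<and> listens zs = k} = 0"
      by (subst measure_pmf_zero_iff) blast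
    then show ?thesis by simp
  next
    case False
    then have "1 \<le> real (card (Y m))" using finY by (simp add: Suc_leI card_gt_0_iff)
    then show ?thesis by (rule order_trans[OF measure_pmf.prob_le_1])
  qed
  then have "(\<Sum>m\<in>A. measure_pmf.prob (hd_trace n bsr bsd brd rel i yr (enc m))
             {zs. dec (map fst zs) = m \<and> listens zs = k}) \<le> (\<Sum>m\<in>A. real (card (Y m)))"
    by (rule sum_mono)
  also have "\<dots> = real (card (\<Union>m\<in>A. Y m))"
    using assms(1) finY by (subst card_UN_disjoint) (auto simp: Y_def)
  also have "\<dots> \<le> card (dest_words n bsd brd N k)"
    using finite_dest_words by (intro of_nat_mono card_mono) (auto simp: Y_def)
  finally show ?thesis .
qed

text \<open>With \<open>brd \<le> bsd\<close> the two letter sets coincide, so the uniform weight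
  \<open>1 / 2 ^ bsd\<close> suffices.\<close>

lemma card_dest_words_le_direct:
  assumes "bsd \<le> n" "brd \<le> bsd" "k \<le> N"
  shows "real (card (dest_words n bsd brd N k)) \<le> 2 ^ (N * bsd)"
proof -
  have "real (card (dest_words n bsd brd N k)) * ((1 / 2 ^ bsd) ^ k * (1 / 2 ^ bsd) ^ (N - k)) \<le> 1"
    unfolding dest_words_def using assms(1,2)
    by (intro card_words_many_in_le) (auto simp: max_def card_dest_range finite_dest_range)
  then show ?thesis
    using assms(3) by (simp add: power_add[symmetric] power_one_over power_mult[symmetric]
        distrib_left[symmetric] mult.commute field_simps)
qed

lemma card_dest_words_le_entropy:
  assumes "brd \<le> n" "bsd < brd" "k \<le> N" "0 < N"
  shows "real (card (dest_words n bsd brd N k))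
           \<le> 2 powr (real N * (real bsd + top_entropy (2 ^ (brd - bsd)) (real k / real N)))"
proof -
  define L :: real where "L = 2 ^ (brd - bsd)"
  define g where "g = max (1 / L) (real k / real N)"
  have L: "2 \<le> L" 
    unfolding L_def using assms(2) power_increasing[of 1 "brd - bsd" "2::real"] by simp
  have g: "1 / L \<le> g" "g \<le> 1" "0 \<le> g" using assms(3,4) L by (auto simp: g_def le_max_iff_disj)
  have LL: "2 ^ bsd * L = 2 ^ brd" using assms(2) by (simp add: L_def power_add[symmetric])
  have q: "0 \<le> (1 - g) / (L - 1)" using g L by simp
  \<comment> \<open>The lower bound \<open>1 / L \<le> g\<close> makes the letters seen while
    listening the heavier ones, as the weighted count demands.\<close>
  have "(1 - g) / (L - 1) \<le> 1 / L"
    using g L by (simp add: field_simps)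
  then have qp: "(1 - g) / (L - 1) \<le> g" using g(1) by linarith
  have cZ: "card (dest_range n bsd) = 2 ^ bsd" "card (dest_range n (max bsd brd)) = 2 ^ brd"
    using assms(1,2) by (simp_all add: card_dest_range max_def)
  have sub: "dest_range n bsd \<subseteq> dest_range n (max bsd brd)" by (rule dest_range_mono) simp
  have cD: "real (card (dest_range n (max bsd brd) - dest_range n bsd)) = 2 ^ bsd * (L - 1)"
    using card_Diff_subset[OF finite_dest_range sub] cZ LL assms(2)
    by (simp add: algebra_simps of_nat_diff)
  \<comment> \<open>The weights belong to the distribution in which the top \<open>brd - bsd\<close>
    bits are all zero with probability \<open>g\<close> and otherwise uniform over the nonzero
    patterns, with the lower \<open>bsd\<close> bits uniform and independent.\<close>
  have "real (card (dest_words n bsd brd N k)) *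
     ((g / 2 ^ bsd) ^ k * ((1 - g) / (L - 1) / 2 ^ bsd) ^ (N - k)) \<le> 1"
    unfolding dest_words_def
  proof (rule card_words_many_in_le[OF finite_dest_range sub])
    show "(1 - g) / (L - 1) / 2 ^ bsd \<le> g / 2 ^ bsd" using qp by (rule divide_right_mono) simp
    show "real (card (dest_range n bsd)) * (g / 2 ^ bsd) +
        real (card (dest_range n (max bsd brd) - dest_range n bsd)) * ((1 - g) / (L - 1) / 2 ^ bsd) \<le> 1"
      unfolding cD using cZ L by simp
  qed (intro divide_nonneg_pos q, simp)
  also have "(g / 2 ^ bsd) ^ k * ((1 - g) / (L - 1) / 2 ^ bsd) ^ (N - k)
      = (g ^ k * ((1 - g) / (L - 1)) ^ (N - k)) / 2 ^ (N * bsd)"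
  proof -
    have "(2::real) ^ (N * bsd) = (2 ^ bsd) ^ k * (2 ^ bsd) ^ (N - k)"
      using assms(3) by (simp flip: power_add power_mult distrib_right add: mult.commute[of bsd])
    then show ?thesis by (simp add: power_divide power_mult_distrib)
  qed
  also have "\<dots> = 2 powr (- (real N * top_entropy L (real k / real N))) / 2 powr (real (N * bsd))"
    unfolding g_def type_weight_eq[OF L assms(3,4)] by (simp only: powr_realpow[of 2] zero_less_numeral)
  also have "\<dots> = 2 powr (- (real N * (real bsd + top_entropy L (real k / real N))))"
    unfolding powr_diff[symmetric] by (rule arg_cong[where f = "(powr) 2"]) (simp add: distrib_left)
  finally show ?thesis
    by (simp add: powr_minus_divide L_def[symmetric])
qed

section \<open>Combination of the two cuts\<close>

lemma cap_formula_eq: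
  assumes "bsd < bsr" "bsd < brd"
  shows "cap_formula bsr bsd brd = real bsd +
    (SUP \<gamma>\<in>{0..1}. min (top_entropy (2 ^ (brd - bsd)) \<gamma>) (\<gamma> * real (bsr - bsd)))"
  using assms by (simp add: cap_formula_def top_entropy_def Let_def del: of_nat_diff)

lemma bdd_above_cap_summand:
  "bdd_above ((\<lambda>\<gamma>. min (top_entropy L \<gamma>) (\<gamma> * real d)) ` {0..1})"
  by (rule bdd_aboveI2[where M = "real d"])
    (auto intro!: min.coboundedI2 mult_left_le_one_le)

lemma correct_decoding_bound:
  fixes bsr bsd brd M :: nat
  defines "n \<equiv> max bsr (max bsd brd)"
  assumes len: "\<And>m. length (enc m) = N"
  shows "(\<Sum>m<M. measure_pmf.prob (hd_run n bsr bsd brd rel 0 [] (enc m)) {y. dec y = m})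
           \<le> (real N + 1) * 2 powr (real N * cap_formula bsr bsd brd)"
proof -
  define S where "S k = (\<Sum>m<M. measure_pmf.prob (hd_trace n bsr bsd brd rel 0 [] (enc m))
             {zs. dec (map fst zs) = m \<and> listens zs = k})" for k
  have n: "bsr \<le> n" "bsd \<le> n" "brd \<le> n" by (auto simp: n_def)
  have relay: "S k \<le> 2 powr (real N * real bsd + real k * real (bsr - bsd))" for k
    unfolding S_def
    using relay_cut_bound[OF n(1,2) finite_lessThan, of M enc N brd rel 0 "[]" "\<lambda>zs. dec (map fst zs)" k, OF len]
    by (simp add: powr_add powr_realpow power_add flip: of_nat_mult)
  have dest: "S k \<le> card (dest_words n bsd brd N k)" for k
    unfolding S_def using len by (intro dest_cut_bound) auto
  have S: "S k \<le> 2 powr (real N * cap_formula bsr bsd brd)" if k: "k \<le> N" for k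
  proof (cases "bsr > bsd \<and> brd > bsd")
    case False
    \<comment> \<open>If \<open>bsr \<le> bsd\<close> the relay cut has no extra term; if
      \<open>brd \<le> bsd\<close> the destination cut gives the bound.\<close>
    then have "S k \<le> 2 powr (real N * real bsd)"
      using relay[of k] dest[of k] card_dest_words_le_direct[OF n(2) _ k, of brd]
      by (auto simp: not_less powr_realpow[symmetric])
    then show ?thesis using False by (auto simp: cap_formula_def)
  next
    case True
    show ?thesis
    proof (cases "N = 0")
      case True
      then show ?thesis using relay[of k] k by simp
    next
      case False
      define L :: real where "L = 2 ^ (brd - bsd)"
      \<comment> \<open>Runs with \<open>k\<close> listening slots are compared with the term of the
        supremum at \<open>k / N\<close>.\<close>
      define \<gamma> where "\<gamma> = real k / real N"
      have \<gamma>: "\<gamma> \<in> {0..1}" using k by (auto simp: \<gamma>_def divide_le_eq)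
      have "S k \<le> 2 powr (real N * (real bsd + top_entropy L \<gamma>))"
        using dest[of k] card_dest_words_le_entropy[OF n(3) _ k, of bsd] True False
        by (auto simp: L_def \<gamma>_def)
      moreover have "S k \<le> 2 powr (real N * (real bsd + \<gamma> * real (bsr - bsd)))"
        using relay[of k] False by (simp add: \<gamma>_def distrib_left)
      ultimately have "S k \<le> 2 powr (real N * (real bsd + min (top_entropy L \<gamma>) (\<gamma> * real (bsr - bsd))))"
        by (auto simp: min_def)
      also have "\<dots> \<le> 2 powr (real N * cap_formula bsr bsd brd)"
        using True cSUP_upper[OF \<gamma> bdd_above_cap_summand[of L "bsr - bsd"]]
        by (intro powr_mono mult_left_mono) (simp_all add: cap_formula_eq L_def del: of_nat_diff)
      finally show ?thesis .
    qed
  qed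
  have "measure_pmf.prob (hd_run n bsr bsd brd rel 0 [] (enc m)) {y. dec y = m}
      = (\<Sum>k\<le>N. measure_pmf.prob (hd_trace n bsr bsd brd rel 0 [] (enc m))
             {zs. dec (map fst zs) = m \<and> listens zs = k})" for m
  proof -
    let ?T = "hd_trace n bsr bsd brd rel 0 [] (enc m)"
    have "measure_pmf.prob (hd_run n bsr bsd brd rel 0 [] (enc m)) {y. dec y = m}
        = measure_pmf.prob ?T {zs. dec (map fst zs) = m}"
      by (simp add: map_fst_hd_trace[symmetric] vimage_def)
    also have "\<dots> = measure_pmf.prob ?T (\<Union>k\<le>N. {zs. dec (map fst zs) = m \<and> listens zs = k})"
      using listens_le_length[of _ n bsr bsd brd rel 0 "[]" "enc m"] len
      by (intro measure_prob_cong_0) (auto simp: set_pmf_iff)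
    also have "\<dots> = (\<Sum>k\<le>N. measure_pmf.prob ?T {zs. dec (map fst zs) = m \<and> listens zs = k})"
      by (intro measure_pmf.finite_measure_finite_Union) (auto simp: disjoint_family_on_def)
    finally show ?thesis .
  qed
  then have "(\<Sum>m<M. measure_pmf.prob (hd_run n bsr bsd brd rel 0 [] (enc m)) {y. dec y = m}) = (\<Sum>k\<le>N. S k)"
    unfolding S_def by (simp add: sum.swap[of _ "{..<M}"])
  also have "\<dots> \<le> (\<Sum>k\<le>N. 2 powr (real N * cap_formula bsr bsd brd))"
    using S by (intro sum_mono) auto
  finally show ?thesis by (simp add: add.commute)
qed

lemma achievable_le_cap_formula:
  assumes "hd_achievable bsr bsd brd R"
  shows "R \<le> cap_formula bsr bsd brd"
proof (rule ccontr)
  assume less: "\<not> R \<le> cap_formula bsr bsd brd"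
  define n where "n = max bsr (max bsd brd)"
  define C where "C = cap_formula bsr bsd brd"
  \<comment> \<open>With at least \<open>2 powr (N * R)\<close> messages, the average success
    probability is at most \<open>(N + 1) * x ^ N\<close>. This tends to 0 when \<open>R\<close>
    exceeds \<open>C\<close>, so the error would even tend to 1.\<close>
  define x where "x = 2 powr (C - R)"
  have x: "0 < x" "x < 1"
    using less powr_less_mono[of "C - R" 0 2] by (auto simp: x_def C_def)
  obtain enc rel dec where len: "\<And>N m. length (enc N m) = N"
    and lim: "(\<lambda>N. err_prob n bsr bsd brd (nat \<lceil>2 powr (real N * R)\<rceil>) (enc N) (rel N) (dec N))
          \<longlonglongrightarrow> 0"
    using assms by (auto simp: hd_achievable_def Let_def n_def)
  have "1 - err_prob n bsr bsd brd (nat \<lceil>2 powr (real N * R)\<rceil>) (enc N) (rel N) (dec N)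
      \<le> real N * x ^ N + x ^ N" for N
  proof -
    define M where "M = nat \<lceil>2 powr (real N * R)\<rceil>"
    let ?p = "\<lambda>m. measure_pmf.prob (hd_run n bsr bsd brd (rel N) 0 [] (enc N m))"
    have M: "2 powr (real N * R) \<le> real M" unfolding M_def by linarith
    moreover have "0 < 2 powr (real N * R)" by simp
    ultimately have M0: "0 < real M" by linarith
    have "?p m {y. dec N y \<noteq> m} = 1 - ?p m {y. dec N y = m}" for m
      using measure_pmf.prob_compl[of "{y. dec N y = m}" "hd_run n bsr bsd brd (rel N) 0 [] (enc N m)"]
      by (simp add: Compl_eq_Diff_UNIV[symmetric] Collect_neg_eq)
    then have "(\<Sum>m<M. ?p m {y. dec N y \<noteq> m}) = (\<Sum>m<M. 1 - ?p m {y. dec N y = m})"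
      by (intro sum.cong) auto
    also have "\<dots> = real M - (\<Sum>m<M. ?p m {y. dec N y = m})"
      by (simp add: sum_subtractf)
    finally have "1 - err_prob n bsr bsd brd M (enc N) (rel N) (dec N)
        = (\<Sum>m<M. ?p m {y. dec N y = m}) / real M"
      using M0 by (simp add: err_prob_def diff_divide_distrib)
    also have "\<dots> \<le> (real N + 1) * 2 powr (real N * C) / real M"
      using correct_decoding_bound[of "enc N" N bsr bsd brd "rel N" "dec N" M] len
      by (intro divide_right_mono) (auto simp: n_def C_def)
    also have "\<dots> \<le> (real N + 1) * 2 powr (real N * C) / 2 powr (real N * R)"
      using M by (intro divide_left_mono) (auto intro!: mult_pos_pos M0)
    also have "\<dots> = (real N + 1) * (2 powr (real N * C) / 2 powr (real N * R))"
      by simp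
    also have "2 powr (real N * C) / 2 powr (real N * R) = x ^ N"
      unfolding x_def
      by (simp add: powr_realpow[symmetric] powr_powr powr_diff[symmetric] algebra_simps)
    finally show ?thesis by (simp add: M_def algebra_simps)
  qed
  moreover have "(\<lambda>N. real N * x ^ N + x ^ N) \<longlonglongrightarrow> 0 + 0"
    using x by (intro tendsto_add powser_times_n_limit_0 LIMSEQ_power_zero) auto
  moreover have "(\<lambda>N. 1 - err_prob n bsr bsd brd (nat \<lceil>2 powr (real N * R)\<rceil>) (enc N) (rel N) (dec N))
          \<longlonglongrightarrow> 1 - 0"
    by (intro tendsto_diff tendsto_const lim)
  ultimately have "1 - 0 \<le> (0 + 0 :: real)"
    by (intro LIMSEQ_le[of _ "1 - 0" _ "0 + 0"]) auto
  then show False by simp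
qed

section \<open>Achievability\<close>

text \<open>The causality premise lets the relay recompute its input from any message that is consistent with
  its past outputs, so no explicit relay decoder has to be described.\<close>

lemma deterministic_scheme:
  fixes X :: "'a \<Rightarrow> nat \<Rightarrow> bvec" and U :: "'a \<Rightarrow> nat \<Rightarrow> bvec \<times> bool" and n bsr bsd brd :: nat
  defines "yr \<equiv> \<lambda>a i. relay_out n bsr (X a i) (snd (U a i))"
    and "yd \<equiv> \<lambda>a i. dest_out n bsd brd (X a i) (fst (U a i)) (snd (U a i))"
  assumes fin: "finite \<Omega>" and M: "M \<le> card \<Omega>"
    and causal: "\<And>a a' i. a \<in> \<Omega> \<Longrightarrow> a' \<in> \<Omega> \<Longrightarrow> i < N \<Longrightarrow> (\<And>j. j < i \<Longrightarrow> yr a j = yr a' j)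
                   \<Longrightarrow> U a i = U a' i"
    and separated: "\<And>a a'. a \<in> \<Omega> \<Longrightarrow> a' \<in> \<Omega> \<Longrightarrow> (\<And>i. i < N \<Longrightarrow> yd a i = yd a' i) \<Longrightarrow> a = a'"
  shows "\<exists>enc rel dec. (\<forall>m. length (enc m) = N) \<and> err_prob n bsr bsd brd M enc rel dec = 0"
proof -
  obtain f where f: "f ` {..<M} \<subseteq> \<Omega>" "inj_on f {..<M}"
    using card_le_inj[of "{..<M}" \<Omega>] fin M by auto
  define enc where "enc m = map (X (f m)) [0..<N]" for m
  define rel :: relay_strategy where
    "rel i ys = return_pmf (U (SOME a. a \<in> \<Omega> \<and> ys = map (yr a) [0..<i]) i)" for i ys
  define out where "out m = map (yd (f m)) [0..<N]" for m
  define dec where "dec = inv_into {..<M} out"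
  have rel: "rel i (map (yr a) [0..<i]) = return_pmf (U a i)" if "a \<in> \<Omega>" "i < N" for a i
  proof -
    define a' where "a' = (SOME a'. a' \<in> \<Omega> \<and> map (yr a) [0..<i] = map (yr a') [0..<i])"
    have "a' \<in> \<Omega> \<and> map (yr a) [0..<i] = map (yr a') [0..<i]"
      unfolding a'_def by (rule someI[of _ a]) (use that in auto)
    then have "U a' i = U a i" using that by (intro causal) auto
    then show ?thesis unfolding rel_def a'_def[symmetric] by simp
  qed
  \<comment> \<open>Induction on the number \<open>k\<close> of slots still to come, since
    \<open>hd_run\<close> consumes the input from the front and needs the whole past of the
    relay.\<close>
  have run: "hd_run n bsr bsd brd rel (N - k) (map (yr a) [0..<N - k]) (map (X a) [N - k..<N])
          = return_pmf (map (yd a) [N - k..<N])" if "a \<in> \<Omega>" "k \<le> N" for a k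
    using that(2)
  proof (induction k)
    case (Suc k)
    define i where "i = N - Suc k"
    have i: "i < N" "Suc i = N - k" using Suc.prems by (auto simp: i_def)
    have "hd_run n bsr bsd brd rel (Suc i) (map (yr a) [0..<i] @ [yr a i]) (map (X a) [Suc i..<N])
        = return_pmf (map (yd a) [Suc i..<N])"
      using Suc.IH Suc.prems upt_Suc_append[of 0 i] by (simp flip: i(2))
    then have "hd_run n bsr bsd brd rel i (map (yr a) [0..<i]) (map (X a) [i..<N])
        = return_pmf (map (yd a) [i..<N])"
      using i(1) rel[OF that(1) i(1)]
      by (simp add: upt_conv_Cons bind_return_pmf split_beta yr_def yd_def)
    then show ?case by (simp add: i_def)
  qed simp
  have "inj_on out {..<M}"
  proof (rule inj_onI)
    fix m m' assume m: "m \<in> {..<M}" "m' \<in> {..<M}" "out m = out m'"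
    then have "f m = f m'" using f(1) by (intro separated) (auto simp: out_def)
    then show "m = m'" using f(2) m by (auto dest: inj_onD)
  qed
  then have dec: "dec (out m) = m" if "m < M" for m
    unfolding dec_def using that by (intro inv_into_f_f) auto
  have "hd_run n bsr bsd brd rel 0 [] (enc m) = return_pmf (out m)" if "m < M" for m
    using run[of "f m" N] f(1) that by (auto simp: enc_def out_def)
  then have "err_prob n bsr bsd brd M enc rel dec = 0"
    by (simp add: err_prob_def dec)
  moreover have "\<forall>m. length (enc m) = N" by (simp add: enc_def)
  ultimately show ?thesis by blast
qed

section \<open>Block Markov coding\<close>

lemma shiftv_nth: "b \<le> n \<Longrightarrow> l < b \<Longrightarrow> shiftv n (n - b) x (n - b + l) = x l"
  by (auto simp: shiftv_def)

lemma shiftv_nth_above: "i < n - b \<Longrightarrow> shiftv n (n - b) x i = False"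
  by (auto simp: shiftv_def)

text \<open>The positions from \<open>n - brd\<close> up to \<open>n - bsd - 1\<close> lie above the
  reach of the source, so the relay's first \<open>brd - bsd\<close> components arrive
  undisturbed.\<close>

lemma dest_out_relay_only:
  assumes "bsd < brd" "brd \<le> n" "l < brd - bsd"
  shows "dest_out n bsd brd x xr sr (n - brd + l) = (sr \<and> xr l)"
proof -
  have "n - brd + l < n - bsd" "l < brd" using assms by linarith+
  then show ?thesis
    using assms(2) unfolding dest_out_def by (metis shiftv_nth shiftv_nth_above)
qed

lemma dest_out_both:
  assumes "bsd < brd" "brd \<le> n" "l < bsd"
  shows "dest_out n bsd brd x xr sr (n - bsd + l) = (x l \<noteq> (sr \<and> xr (brd - bsd + l)))"
proof -
  have "n - bsd + l = n - brd + (brd - bsd + l)" "brd - bsd + l < brd" "bsd \<le> n"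
    using assms by linarith+
  then show ?thesis
    using assms(2,3) unfolding dest_out_def by (metis shiftv_nth)
qed

text \<open>Used to find the listening slot of a block that carries a given portion of the next
  block's description.\<close>

lemma exists_element_of_rank:
  fixes P :: "nat \<Rightarrow> bool"
  assumes "r < card {j. j < B \<and> P j}"
  shows "\<exists>j<B. P j \<and> card {j'. j' < j \<and> P j'} = r"
  using assms
proof (induction B)
  case (Suc B)
  show ?case
  proof (cases "r < card {j. j < B \<and> P j}")
    case True
    then show ?thesis using Suc.IH less_Suc_eq by blast
  next
    case False
    have "{j. j < Suc B \<and> P j} = (if P B then insert B {j. j < B \<and> P j} else {j. j < B \<and> P j})"
      by (auto simp: less_Suc_eq)
    then have "P B" "r = card {j. j < B \<and> P j}"
      using False Suc.prems by (auto split: if_splits)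
    then show ?thesis by auto
  qed
qed simp

lemma block_time_less:
  fixes B t i j :: nat
  assumes "j < B" "t < i div B"
  shows "B * t + j < i"
proof -
  have "B * t + j < B * Suc t" using assms by simp
  also have "\<dots> \<le> B * (i div B)" using assms by (intro mult_le_mono2) simp
  also have "\<dots> \<le> i" by simp
  finally show ?thesis .
qed

lemma block_markov_scheme:
  fixes bsr bsd brd B b k N M :: nat and \<C> :: "(nat \<Rightarrow> nat set) set"
  defines "n \<equiv> max bsr (max bsd brd)"
  assumes bsr: "bsd < bsr" and brd: "bsd < brd"
    and code: "\<C> \<subseteq> PiE {..<B} (\<lambda>_. Pow {..<brd - bsd})"
    and listen: "\<And>c. c \<in> \<C> \<Longrightarrow> card {j. j < B \<and> c j = {}} = k"
    and card_le: "card \<C> \<le> 2 ^ (k * (bsr - bsd))" and c0: "c0 \<in> \<C>"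
    and Bb: "0 < B" "B * b \<le> N"
    and M: "M \<le> (2 ^ bsd) ^ N * card \<C> ^ (b - 1)"
  shows "\<exists>enc rel dec. (\<forall>m. length (enc m) = N) \<and> err_prob n bsr bsd brd M enc rel dec = 0"
proof -
  define \<delta> where "\<delta> = bsr - bsd"
  have \<delta>: "0 < \<delta>" using bsr by (simp add: \<delta>_def)
  have finC: "finite \<C>" by (rule finite_subset[OF code]) (simp add: finite_PiE)
  \<comment> \<open>\<open>\<psi>\<close> describes a code word by \<open>k * \<delta>\<close> bits,
    which is what the relay can pick up in the \<open>k\<close> listening slots of one
    block.\<close>
  obtain \<psi> where \<psi>: "\<psi> ` \<C> \<subseteq> Pow {..<k * \<delta>}" "inj_on \<psi> \<C>"
    using card_le_inj[OF finC, of "Pow {..<k * \<delta>}"] card_le by (auto simp: card_Pow \<delta>_def)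
  \<comment> \<open>A letter is the set of its nonzero bit positions. A message consists of the directly sent bits and the
    relay's words for blocks \<open>1..<b\<close>; block \<open>0\<close> and the incomplete last block use \<open>c0\<close>.\<close>
  define \<Omega> :: "((nat \<Rightarrow> nat set) \<times> (nat \<Rightarrow> nat \<Rightarrow> nat set)) set" where
    "\<Omega> = PiE {..<N} (\<lambda>_. Pow {..<bsd}) \<times> PiE {1..<b} (\<lambda>_. \<C>)"
  define v where "v a t = (if 1 \<le> t \<and> t < b then snd a t else c0)"
    for a :: "(nat \<Rightarrow> nat set) \<times> (nat \<Rightarrow> nat \<Rightarrow> nat set)" and t
  define \<rho> where "\<rho> c j = card {j'. j' < j \<and> c j' = {}}" for c :: "nat \<Rightarrow> nat set" and j
  \<comment> \<open>The components from \<open>bsd\<close> on describe the word of the next block: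
    the listening slot of rank \<open>r\<close> carries the \<open>\<delta>\<close> bits of its
    \<open>\<psi>\<close> image starting at \<open>r * \<delta>\<close>. In transmitting slots these
    components reach neither receiver.\<close>
  define X where "X a i l = (if l < bsd then l \<in> fst a i
       else \<rho> (v a (i div B)) (i mod B) * \<delta> + (l - bsd) \<in> \<psi> (v a (Suc (i div B))))" for a i l
  \<comment> \<open>Silence is itself a letter: the relay listens exactly when its letter is empty,
    and the destination then sees zeros in the positions reserved for the relay.\<close>
  define U where "U a i = ((\<lambda>l. l \<in> v a (i div B) (i mod B)), v a (i div B) (i mod B) \<noteq> {})" for a i
  have v: "v a t \<in> \<C>" if "a \<in> \<Omega>" for a t
    using that c0 by (auto simp: v_def \<Omega>_def PiE_iff)
  have n: "bsr \<le> n" "brd \<le> n" by (auto simp: n_def)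
  show ?thesis
  proof (rule deterministic_scheme)
    show "finite \<Omega>" unfolding \<Omega>_def using finC by (intro finite_cartesian_product finite_PiE) auto
    show "M \<le> card \<Omega>"
      using M by (simp add: \<Omega>_def card_cartesian_product card_PiE card_Pow)
  next
    fix a a' i
    assume a: "a \<in> \<Omega>" "a' \<in> \<Omega>"
      and eq: "\<And>j. j < i \<Longrightarrow> relay_out n bsr (X a j) (snd (U a j)) = relay_out n bsr (X a' j) (snd (U a' j))"
    \<comment> \<open>Block by block: the common word of block \<open>t\<close> fixes which slots
      are listened to, and what is heard there determines the word of block
      \<open>t + 1\<close>.\<close>
    have "v a t = v a' t" if "t \<le> i div B" for t
      using that
    proof (induction t)
      case (Suc t)
      define c where "c = v a t"
      have c: "v a t = c" "v a' t = c" "c \<in> \<C>" using Suc v[OF a(1), of t] by (auto simp: c_def)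
      have "p \<in> \<psi> (v a (Suc t)) \<longleftrightarrow> p \<in> \<psi> (v a' (Suc t))" if p: "p < k * \<delta>" for p
      proof -
        have "p div \<delta> < k" using p by (simp add: less_mult_imp_div_less)
        then obtain j where j: "j < B" "c j = {}" "\<rho> c j = p div \<delta>"
          using exists_element_of_rank[of "p div \<delta>" B "\<lambda>j. c j = {}"] listen[OF c(3)]
          by (auto simp: \<rho>_def)
        \<comment> \<open>The slot that carries bit \<open>p\<close>. It precedes \<open>i\<close>
          because block \<open>t\<close> ends before the block of \<open>i\<close> begins.\<close>
        define i' where "i' = B * t + j"
        have i': "i' div B = t" "i' mod B = j" "i' < i"
          using j(1) block_time_less[OF j(1), of t i] Suc.prems by (auto simp: i'_def)
        define l where "l = bsd + p mod \<delta>"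
        have l: "l < bsr" "\<not> l < bsd" "l - bsd = p mod \<delta>"
          using mod_less_divisor[OF \<delta>, of p] by (auto simp: l_def \<delta>_def)
        have "relay_out n bsr (X a i') False = relay_out n bsr (X a' i') False"
          using eq[OF i'(3)] by (simp add: U_def i' c j(2))
        then have "relay_out n bsr (X a i') False (n - bsr + l) = relay_out n bsr (X a' i') False (n - bsr + l)"
          by simp
        then have "X a i' l = X a' i' l"
          using shiftv_nth[of bsr n l] n(1) l(1) by (simp only: relay_out_def if_False)
        then show ?thesis
          using l by (simp add: X_def i' c j)
      qed
      then have "\<psi> (v a (Suc t)) = \<psi> (v a' (Suc t))"
        using \<psi>(1) v[OF a(1), of "Suc t"] v[OF a(2), of "Suc t"] by blast
      then show ?case using inj_onD[OF \<psi>(2)] v a by blast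
    qed (simp add: v_def)
    then show "U a i = U a' i" by (simp add: U_def)
  next
    fix a a'
    assume a: "a \<in> \<Omega>" "a' \<in> \<Omega>"
      and eq: "\<And>i. i < N \<Longrightarrow> dest_out n bsd brd (X a i) (fst (U a i)) (snd (U a i))
                            = dest_out n bsd brd (X a' i) (fst (U a' i)) (snd (U a' i))"
    have vsub: "v a t j \<subseteq> {..<brd - bsd}" if "a \<in> \<Omega>" "j < B" for a t j
      using v[OF that(1), of t] code that(2) by (auto simp: PiE_iff)
    have top: "v a (i div B) (i mod B) = v a' (i div B) (i mod B)" if "i < N" for i
    proof -
      have "l \<in> v a (i div B) (i mod B) \<longleftrightarrow> l \<in> v a' (i div B) (i mod B)" if l: "l < brd - bsd" for l
        using fun_cong[OF eq[OF \<open>i < N\<close>], of "n - brd + l"]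
        unfolding dest_out_relay_only[OF brd n(2) l] by (auto simp: U_def)
      moreover have "v a (i div B) (i mod B) \<subseteq> {..<brd - bsd}" "v a' (i div B) (i mod B) \<subseteq> {..<brd - bsd}"
        using vsub a Bb(1) by simp_all
      ultimately show ?thesis by blast
    qed
    have low: "l \<in> fst a i \<longleftrightarrow> l \<in> fst a' i" if "i < N" "l < bsd" for i l
    proof -
      \<comment> \<open>Code letters use only positions below \<open>brd - bsd\<close>, so the relay
        components that overlap the source bits at the destination are zero.\<close>
      have "brd - bsd + l \<notin> v a (i div B) (i mod B)" if "a \<in> \<Omega>" for a
        using vsub[OF that, of "i mod B" "i div B"] Bb(1) by auto
      then have "brd - bsd + l \<notin> v a (i div B) (i mod B)" "brd - bsd + l \<notin> v a' (i div B) (i mod B)"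
        using a by blast+
      then show ?thesis
        using fun_cong[OF eq[OF \<open>i < N\<close>], of "n - bsd + l"] that(2)
        unfolding dest_out_both[OF brd n(2) that(2)] by (simp add: U_def X_def)
    qed
    have "fst a = fst a'"
    proof (rule PiE_ext)
      show "fst a \<in> PiE {..<N} (\<lambda>_. Pow {..<bsd})" "fst a' \<in> PiE {..<N} (\<lambda>_. Pow {..<bsd})"
        using a unfolding \<Omega>_def mem_Times_iff by simp_all
      then have "fst a i \<subseteq> {..<bsd}" "fst a' i \<subseteq> {..<bsd}" if "i \<in> {..<N}" for i
        using that by (metis PiE_mem Pow_iff)+
      then show "fst a i = fst a' i" if "i \<in> {..<N}" for i
        using low[of i] that by blast
    qed
    moreover have "snd a = snd a'"
    proof (rule PiE_ext)
      show "snd a \<in> PiE {1..<b} (\<lambda>_. \<C>)" "snd a' \<in> PiE {1..<b} (\<lambda>_. \<C>)"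
        using a unfolding \<Omega>_def mem_Times_iff by simp_all
      fix t assume t: "t \<in> {1..<b}"
      have "v a t = v a' t"
      proof (rule PiE_ext)
        show "v a t \<in> PiE {..<B} (\<lambda>_. Pow {..<brd - bsd})" "v a' t \<in> PiE {..<B} (\<lambda>_. Pow {..<brd - bsd})"
          using v[OF a(1), of t] v[OF a(2), of t] code by blast+
        fix j assume j: "j \<in> {..<B}"
        have "B * t + j < B * b"
          using block_time_less[of j B t "B * b"] j t Bb(1) by simp
        then show "v a t j = v a' t j"
          using top[of "B * t + j"] j Bb by simp
      qed
      then show "snd a t = snd a' t" using t by (simp add: v_def)
    qed
    ultimately show "a = a'" by (simp add: prod_eq_iff)
  qed
qed

section \<open>Size of a type class\<close>

lemma fact_mult_power_le: "fact k * k ^ j \<le> fact j * (k::nat) ^ k"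
proof -
  \<comment> \<open>For \<open>k > 0\<close> the quotient \<open>fact j / k ^ j\<close> changes by
    the factor \<open>(j + 1) / k\<close> from \<open>j\<close> to \<open>j + 1\<close>, so it is
    smallest at \<open>j = k\<close>. The bounds \<open>up\<close> and \<open>down\<close> treat
    \<open>j\<close> below and above \<open>k\<close>; the product form also covers
    \<open>k = 0\<close>.\<close>
  have up: "fact (j + d) \<le> fact j * (j + d) ^ d" for j d :: nat
  proof (induction d)
    case (Suc d)
    have "fact (j + Suc d) = (j + Suc d) * fact (j + d)" by simp
    also have "\<dots> \<le> (j + Suc d) * (fact j * (j + d) ^ d)" using Suc by (rule mult_le_mono2)
    also have "\<dots> \<le> (j + Suc d) * (fact j * (j + Suc d) ^ d)"
      by (intro mult_le_mono2 power_mono) auto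
    finally show ?case by (simp add: mult_ac)
  qed simp
  have down: "fact k * k ^ d \<le> fact (k + d)" for k d :: nat
  proof (induction d)
    case (Suc d)
    have "fact k * k ^ Suc d = k * (fact k * k ^ d)" by simp
    also have "\<dots> \<le> (k + Suc d) * fact (k + d)" using Suc by (intro mult_le_mono) auto
    finally show ?case by simp
  qed simp
  show ?thesis
  proof (cases "j \<le> k")
    case True
    then obtain d where d: "k = j + d" using le_Suc_ex by blast
    have "fact k * k ^ j \<le> fact j * k ^ d * k ^ j" using up[of j d] d by (intro mult_le_mono1) auto
    also have "\<dots> = fact j * k ^ k" using d by (simp add: power_add mult_ac)
    finally show ?thesis .
  next
    case False
    then obtain d where d: "j = k + d" using le_Suc_ex nat_le_linear by blast
    have "fact k * k ^ j = fact k * k ^ d * k ^ k" using d by (simp add: power_add mult_ac)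
    also have "\<dots> \<le> fact j * k ^ k" using down[of k d] d by (intro mult_le_mono1) auto
    finally show ?thesis .
  qed
qed

text \<open>The binomial distribution with success probability \<open>k / B\<close> has its mode at
  \<open>k\<close>. After multiplication by \<open>fact k * fact (B - k)\<close> this is
  \<open>fact_mult_power_le\<close> for \<open>k\<close> and for \<open>B - k\<close>.\<close>

lemma binomial_term_le_mode:
  assumes "j \<le> B" "k \<le> (B::nat)"
  shows "(B choose j) * k ^ j * (B - k) ^ (B - j) \<le> (B choose k) * k ^ k * (B - k) ^ (B - k)"
proof -
  have "(B choose j) * k ^ j * (B - k) ^ (B - j) * (fact k * fact (B - k))
      = (B choose j) * ((fact k * k ^ j) * (fact (B - k) * (B - k) ^ (B - j)))"
    by (simp add: mult_ac)
  also have "\<dots> \<le> (B choose j) * ((fact j * k ^ k) * (fact (B - j) * (B - k) ^ (B - k)))"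
    by (intro mult_le_mono fact_mult_power_le order_refl)
  also have "\<dots> = (fact j * fact (B - j) * (B choose j)) * (k ^ k * (B - k) ^ (B - k))"
    by (simp add: mult_ac)
  also have "\<dots> = (fact k * fact (B - k) * (B choose k)) * (k ^ k * (B - k) ^ (B - k))"
    using binomial_fact_lemma[OF assms(1)] binomial_fact_lemma[OF assms(2)] by simp
  also have "\<dots> = (B choose k) * k ^ k * (B - k) ^ (B - k) * (fact k * fact (B - k))"
    by (simp add: mult_ac)
  finally show ?thesis by simp
qed

lemma power_self_le_binomial_mode:
  assumes "k \<le> (B::nat)"
  shows "B ^ B \<le> (B + 1) * ((B choose k) * k ^ k * (B - k) ^ (B - k))"
proof -
  have "B ^ B = (k + (B - k)) ^ B" using assms by simp
  also have "\<dots> = (\<Sum>j\<le>B. (B choose j) * k ^ j * (B - k) ^ (B - j))"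
    by (subst binomial) simp
  also have "\<dots> \<le> (\<Sum>j\<le>B. (B choose k) * k ^ k * (B - k) ^ (B - k))"
    using assms by (intro sum_mono binomial_term_le_mode) auto
  finally show ?thesis by simp
qed

text \<open>The largest of the \<open>B + 1\<close> terms of the binomial expansion of
  \<open>B ^ B\<close> is at least the average. Division by \<open>B ^ B\<close> leaves the weight
  of \<open>type_weight_eq\<close>, where \<open>1 / L \<le> k / B\<close> makes the maximum equal
  to \<open>k / B\<close>.\<close>

lemma type_class_size_ge:
  fixes L :: real
  assumes "2 \<le> L" "k \<le> B" "0 < B" "1 / L \<le> real k / real B"
  shows "2 powr (real B * top_entropy L (real k / real B))
           \<le> (real B + 1) * (real (B choose k) * (L - 1) ^ (B - k))"
proof -
  define g where "g = real k / real B"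
  have g: "max (1 / L) g = g" using assms(4) by (simp add: g_def)
  have g1: "1 - g = real (B - k) / real B" using assms(2,3) by (simp add: g_def field_simps)
  have BB: "real B ^ B = real B ^ k * real B ^ (B - k)" using assms(2) by (simp add: power_add[symmetric])
  have "real (B ^ B) \<le> real ((B + 1) * ((B choose k) * k ^ k * (B - k) ^ (B - k)))"
    using power_self_le_binomial_mode[OF assms(2)] by (rule of_nat_mono)
  then have "real B ^ B \<le> (real B + 1) * real (B choose k) * (real k ^ k * real (B - k) ^ (B - k))"
    by (simp add: algebra_simps del: of_nat_diff)
  also have "real k ^ k * real (B - k) ^ (B - k) = real B ^ B * (g ^ k * (1 - g) ^ (B - k))"
    unfolding g1 BB using assms(3) by (simp add: g_def power_divide del: of_nat_diff)
  finally have "real B ^ B * 1 \<le> real B ^ B * ((real B + 1) * real (B choose k) * (g ^ k * (1 - g) ^ (B - k)))"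
    by (simp add: mult_ac)
  then have "1 \<le> (real B + 1) * real (B choose k) * (g ^ k * (1 - g) ^ (B - k))"
    by (rule mult_left_le_imp_le) (use assms(3) in simp)
  also have "(1 - g) ^ (B - k) = (L - 1) ^ (B - k) * ((1 - g) / (L - 1)) ^ (B - k)"
    using assms(1) by (simp add: power_divide)
  also have "g ^ k * ((L - 1) ^ (B - k) * ((1 - g) / (L - 1)) ^ (B - k))
      = (L - 1) ^ (B - k) * 2 powr (- (real B * top_entropy L g))"
    using type_weight_eq[OF assms(1-3)] g unfolding g_def by (simp add: mult_ac)
  finally show ?thesis
    by (simp add: powr_minus_divide g_def mult_ac)
qed

text \<open>Partition by the set \<open>J\<close> of positions with the empty letter; each of the
  other \<open>B - k\<close> positions has \<open>2 ^ e - 1\<close> choices.\<close>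

lemma card_words_with_empty_letters:
  "card {c \<in> PiE {..<B} (\<lambda>_. Pow {..<e}). card {j. j < B \<and> c j = {}} = k}
     = (B choose k) * (2 ^ e - 1) ^ (B - k)"
proof -
  define W where "W J = PiE {..<B} (\<lambda>j. if j \<in> J then {{}} else Pow {..<e} - {{}} :: nat set set)" for J
  have W: "c \<in> W J \<longleftrightarrow> c \<in> PiE {..<B} (\<lambda>_. Pow {..<e}) \<and> {j. j < B \<and> c j = {}} = J"
    if "J \<subseteq> {..<B}" for c J
    using that by (auto simp: W_def PiE_iff split: if_splits)
  have "{c \<in> PiE {..<B} (\<lambda>_. Pow {..<e}). card {j. j < B \<and> c j = {}} = k}
      = (\<Union>J\<in>{J. J \<subseteq> {..<B} \<and> card J = k}. W J)" (is "?L = ?R")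
  proof (intro equalityI subsetI)
    fix c assume c: "c \<in> ?L"
    have J: "{j. j < B \<and> c j = {}} \<subseteq> {..<B}" by auto
    with c have "c \<in> W {j. j < B \<and> c j = {}}" unfolding W[OF J] by simp
    with c J show "c \<in> ?R" by (intro UN_I[of "{j. j < B \<and> c j = {}}"]) simp_all
  next
    fix c assume "c \<in> ?R"
    then obtain J where "J \<subseteq> {..<B}" "card J = k" "c \<in> W J" by blast
    with W[of J c] show "c \<in> ?L" by simp
  qed
  moreover have "card (\<Union>J\<in>{J. J \<subseteq> {..<B} \<and> card J = k}. W J)
      = (\<Sum>J\<in>{J. J \<subseteq> {..<B} \<and> card J = k}. card (W J))"
  proof (rule card_UN_disjoint)
    show "finite {J. J \<subseteq> {..<B} \<and> card J = k}" by simp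
    show "\<forall>J\<in>{J. J \<subseteq> {..<B} \<and> card J = k}. finite (W J)" by (auto simp: W_def intro!: finite_PiE)
    show "\<forall>J\<in>{J. J \<subseteq> {..<B} \<and> card J = k}. \<forall>J'\<in>{J. J \<subseteq> {..<B} \<and> card J = k}. J \<noteq> J' \<longrightarrow> W J \<inter> W J' = {}"
    proof (intro ballI impI equals0I)
      fix J J' c
      assume "J \<in> {J. J \<subseteq> {..<B} \<and> card J = k}" "J' \<in> {J. J \<subseteq> {..<B} \<and> card J = k}"
        "J \<noteq> J'" "c \<in> W J \<inter> W J'"
      then have "{j. j < B \<and> c j = {}} = J" "{j. j < B \<and> c j = {}} = J'"
        using W[of J c] W[of J' c] by blast+
      with \<open>J \<noteq> J'\<close> show False by simp
    qed
  qed
  moreover have "card (W J) = (2 ^ e - 1) ^ (B - k)" if "J \<subseteq> {..<B}" "card J = k" for J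
  proof -
    have "card (W J) = (\<Prod>j<B. if j \<in> J then 1 else 2 ^ e - 1)"
      by (auto simp: W_def card_PiE card_Pow card_Diff_singleton intro!: prod.cong)
    also have "\<dots> = (2 ^ e - 1) ^ card ({..<B} - J)"
      by (simp add: prod.If_cases Diff_eq)
    also have "card ({..<B} - J) = B - k"
      using that card_Diff_subset[of J "{..<B}"] finite_subset by fastforce
    finally show ?thesis .
  qed
  ultimately show ?thesis by (simp add: n_subsets)
qed

lemma exists_code_of_rate:
  fixes bsr bsd brd :: nat and R :: real
  assumes "bsd < bsr" "bsd < brd"
    and R: "R < (SUP \<gamma>\<in>{0..1}. min (top_entropy (2 ^ (brd - bsd)) \<gamma>) (\<gamma> * real (bsr - bsd)))"
  obtains B and \<C> :: "(nat \<Rightarrow> nat set) set" and k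
  where "0 < B" "\<C> \<subseteq> PiE {..<B} (\<lambda>_. Pow {..<brd - bsd})"
    "\<And>c. c \<in> \<C> \<Longrightarrow> card {j. j < B \<and> c j = {}} = k"
    "card \<C> \<le> 2 ^ (k * (bsr - bsd))" "0 < card \<C>" "real B * R < log 2 (real (card \<C>))"
proof -
  define L :: real where "L = 2 ^ (brd - bsd)"
  have L: "2 \<le> L"
    unfolding L_def using assms(2) power_increasing[of 1 "brd - bsd" "2::real"] by simp
  define \<delta> where "\<delta> = bsr - bsd"
  define W where "W B k = {c \<in> PiE {..<B} (\<lambda>_. Pow {..<brd - bsd}). card {j. j < B \<and> c j = {}} = k}" for B k :: nat
  define T where "T B k = (B choose k) * (2 ^ (brd - bsd) - 1) ^ (B - k)" for B k
  have "\<exists>B k. 0 < B \<and> real B * R < log 2 (real (min (T B k) (2 ^ (k * \<delta>)))) \<and> 0 < T B k"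
  proof (cases "R < 0")
    case True
    \<comment> \<open>Any nonempty code beats a negative rate, even at block length 1.\<close>
    then show ?thesis by (intro exI[of _ 1]) (simp add: T_def)
  next
    case False
    obtain \<gamma> where \<gamma>: "\<gamma> \<in> {0..1}" "R < top_entropy L \<gamma>" "R < \<gamma> * real \<delta>"
      using R unfolding less_cSUP_iff[OF _ bdd_above_cap_summand, simplified] L_def \<delta>_def by auto
    define h where "h g = g * log 2 (1 / g) + (1 - g) * log 2 ((L - 1) / (1 - g))" for g
    have te: "top_entropy L g = h (max (1 / L) g)" if "g < 1" for g
      using that L by (simp add: top_entropy_def theta_star_def xlogy_def h_def)
    \<comment> \<open>At \<open>\<gamma> = 1\<close> the entropy is 0, which contradicts
      \<open>0 \<le> R\<close>. Below 1 the convention in \<open>xlogy\<close> does not intervene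
      and \<open>h\<close> is continuous.\<close>
    have "\<gamma> \<noteq> 1"
      using \<gamma>(2) False L by (auto simp: top_entropy_def theta_star_def xlogy_def max_def)
    \<comment> \<open>Raising \<open>\<gamma>\<close> to at least \<open>1 / L\<close> leaves the
      entropy unchanged and does not lower \<open>\<gamma> * \<delta>\<close>.\<close>
    define g where "g = max (1 / L) \<gamma>"
    have g: "0 < g" "g < 1" "1 / L \<le> g" "\<gamma> \<le> g" "R < h g"
      using \<open>\<gamma> \<noteq> 1\<close> \<gamma> L te[of \<gamma>] by (auto simp: g_def less_max_iff_disj)
    have "isCont h g"
      unfolding h_def using g L by (intro continuous_intros) auto
    then have "\<forall>\<^sub>F x in at_right g. R < h x"
      using g(5) order_tendstoD(1)[of h "h g" "at_right g" R]
      by (simp add: isCont_def filterlim_at_split)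
    moreover have "\<forall>\<^sub>F x in at_right g. x < 1"
      using g(2) by (auto simp: eventually_at_right_field)
    ultimately have "\<forall>\<^sub>F x in at_right g. R < h x \<and> x < 1" by eventually_elim simp
    then obtain u where u: "g < u" "\<And>x. g < x \<Longrightarrow> x < u \<Longrightarrow> R < h x \<and> x < 1"
      by (auto simp: eventually_at_right_field)
    \<comment> \<open>A rational listening fraction can be realised exactly as \<open>k / B\<close>.
      Taking it to the right of \<open>g\<close> preserves \<open>1 / L \<le> r\<close> and
      \<open>R < r * \<delta>\<close>; continuity preserves \<open>R < h r\<close>.\<close>
    obtain r where r: "r \<in> \<rat>" "g < r" "r < u" using Rats_dense_in_real[OF u(1)] by blast
    obtain k0 B0 :: nat where kB: "B0 \<noteq> 0" "\<bar>r\<bar> = real k0 / real B0"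
      using Rats_abs_nat_div_natE[OF r(1)] by metis
    have r': "r = real k0 / real B0" "R < h r" "r < 1" "1 / L \<le> r"
      using kB r u(2)[of r] g by auto
    have k0: "k0 \<le> B0" using r'(1,3) kB(1) by (simp add: divide_less_eq)
    have \<delta>r: "R < r * real \<delta>"
      using \<gamma>(3) g(4) r(2) mult_right_mono[of \<gamma> r "real \<delta>"] by linarith
    \<comment> \<open>The polynomial factor \<open>B + 1\<close> costs
      \<open>log 2 (B + 1) / B\<close> bits per slot. Multiplying numerator and denominator of
      \<open>r\<close> by a large \<open>l\<close> makes this negligible.\<close>
    have "((\<lambda>l::nat. log 2 (real (B0 * l) + 1) / real (B0 * l)) \<longlongrightarrow> 0) at_top"
      using kB(1) unfolding of_nat_mult by real_asymp
    then have "\<forall>\<^sub>F l in at_top. log 2 (real (B0 * l) + 1) / real (B0 * l) < h r - R"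
      using r'(2) by (intro order_tendstoD(2)) auto
    then obtain l :: nat where l: "0 < l" "log 2 (real (B0 * l) + 1) / real (B0 * l) < h r - R"
      using eventually_conj[OF _ eventually_gt_at_top[of 0]] eventually_happens'[OF sequentially_bot]
      by (metis (no_types, lifting))
    define B k where "B = B0 * l" and "k = k0 * l"
    have B: "0 < B" "k \<le> B" and rB: "real k / real B = r"
      using l(1) kB(1) k0 r'(1) by (auto simp: B_def k_def)
    have kB': "real k = real B * r" using rB B(1) by (simp add: field_simps)
    have "top_entropy L r = h r" using te[of r] r' by (simp add: max_def)
    then have T1: "2 powr (real B * h r) \<le> (real B + 1) * real (T B k)"
      using type_class_size_ge[OF L B(2,1)] r'(4) rB by (simp add: T_def L_def of_nat_diff)
    then have T0: "0 < T B k" by (cases "T B k") (auto simp: powr_gt_zero not_le)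
    have "real B * h r \<le> log 2 ((real B + 1) * real (T B k))"
      using T1 T0 by (simp add: le_log_iff)
    also have "\<dots> = log 2 (real B + 1) + log 2 (real (T B k))"
      using T0 by (intro log_mult_pos) auto
    finally have "real B * R < log 2 (real (T B k))"
      using l(2) B(1) unfolding B_def[symmetric]
      by (simp only: pos_divide_less_eq of_nat_0_less_iff) (simp add: algebra_simps)
    moreover have "real B * R < log 2 (real (2 ^ (k * \<delta>)))"
    proof -
      have "real B * R < real B * (r * real \<delta>)" using \<delta>r B(1) by simp
      also have "\<dots> = log 2 (real (2 ^ (k * \<delta>)))" by (simp add: kB')
      finally show ?thesis .
    qed
    ultimately show ?thesis using B(1) T0 by (intro exI[of _ B] exI[of _ k]) (auto simp: min_def)
  qed
  then obtain B k where Bk: "0 < B" "real B * R < log 2 (real (min (T B k) (2 ^ (k * \<delta>))))" "0 < T B k"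
    by blast
  have "card (W B k) = T B k" unfolding W_def T_def by (rule card_words_with_empty_letters)
  then have "min (T B k) (2 ^ (k * \<delta>)) \<le> card (W B k)" by simp
  \<comment> \<open>The set of words is cut down to what \<open>k * \<delta>\<close> bits can
    address.\<close>
  then obtain \<C> where \<C>: "\<C> \<subseteq> W B k" "card \<C> = min (T B k) (2 ^ (k * \<delta>))"
    by (rule obtain_subset_with_card_n)
  show thesis
  proof (rule that)
    show "0 < B" by (rule Bk)
    show "\<C> \<subseteq> PiE {..<B} (\<lambda>_. Pow {..<brd - bsd})"
      using \<C>(1) unfolding W_def by blast
    show "card {j. j < B \<and> c j = {}} = k" if "c \<in> \<C>" for c
      using \<C>(1) that unfolding W_def by blast
    show "card \<C> \<le> 2 ^ (k * (bsr - bsd))" "0 < card \<C>"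
      using \<C>(2) Bk(3) by (simp_all add: \<delta>_def)
    show "real B * R < log 2 (real (card \<C>))" using Bk(2) \<C>(2) by simp
  qed
qed

section \<open>From codes to achievable rates and capacity\<close>

lemma hd_achievableI:
  fixes bsr bsd brd K :: nat and R :: real
  assumes "\<And>N. K \<le> N \<Longrightarrow> \<exists>enc rel dec. (\<forall>m. length (enc m) = N) \<and>
     err_prob (max bsr (max bsd brd)) bsr bsd brd (nat \<lceil>2 powr (real N * R)\<rceil>) enc rel dec = 0"
  shows "hd_achievable bsr bsd brd R"
proof -
  let ?e = "\<lambda>N. err_prob (max bsr (max bsd brd)) bsr bsd brd (nat \<lceil>2 powr (real N * R)\<rceil>)"
  have "\<exists>c. (\<forall>m. length (fst c m) = N) \<and> (K \<le> N \<longrightarrow> ?e N (fst c) (fst (snd c)) (snd (snd c)) = 0)" for N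
  proof (cases "K \<le> N")
    case True
    then show ?thesis using assms[OF True] by auto
  next
    case False
    \<comment> \<open>Below \<open>K\<close> only the length requirement remains, so a constant code
      of zero vectors will do.\<close>
    then show ?thesis by (intro exI[of _ "(\<lambda>_. replicate N (\<lambda>_. False), undefined, undefined)"]) simp
  qed
  then obtain c where c: "\<And>N m. length (fst (c N) m) = N"
    "\<And>N. K \<le> N \<Longrightarrow> ?e N (fst (c N)) (fst (snd (c N))) (snd (snd (c N))) = 0"
    by metis
  have "(\<lambda>N. ?e N (fst (c N)) (fst (snd (c N))) (snd (snd (c N)))) \<longlonglongrightarrow> 0"
    by (rule tendsto_eventually) (use c(2) in \<open>auto simp: eventually_sequentially\<close>)
  then show ?thesis
    unfolding hd_achievable_def Let_def
    by (intro exI[of _ "\<lambda>N. fst (c N)"] exI[of _ "\<lambda>N. fst (snd (c N))"]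
        exI[of _ "\<lambda>N. snd (snd (c N))"]) (simp add: c(1))
qed

text \<open>The relay listens forever and the source sends \<open>bsd\<close> uncoded bits per slot.
  The number of messages is exactly \<open>2 ^ (bsd * N)\<close>, so the rate is attained and not
  merely approached.\<close>

lemma direct_link_achievable: "hd_achievable bsr bsd brd (real bsd)"
proof (rule hd_achievableI[where K = 0])
  fix N :: nat
  define n where "n = max bsr (max bsd brd)"
  have n: "bsd \<le> n" by (simp add: n_def)
  define \<Omega> :: "(nat \<Rightarrow> nat set) set" where "\<Omega> = PiE {..<N} (\<lambda>_. Pow {..<bsd})"
  show "\<exists>enc rel dec. (\<forall>m. length (enc m) = N) \<and>
     err_prob (max bsr (max bsd brd)) bsr bsd brd (nat \<lceil>2 powr (real N * real bsd)\<rceil>) enc rel dec = 0"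
    unfolding n_def[symmetric]
  proof (rule deterministic_scheme[where X = "\<lambda>a i l. l \<in> a i" and U = "\<lambda>_ _. (\<lambda>_. False, False)"])
    show "finite \<Omega>" by (simp add: \<Omega>_def finite_PiE)
    have "2 powr (real N * real bsd) = real ((2 ^ bsd) ^ N)"
      by (simp add: powr_realpow[symmetric] powr_powr mult.commute)
    then have "nat \<lceil>2 powr (real N * real bsd)\<rceil> = (2 ^ bsd) ^ N"
      by (simp only: ceiling_of_nat nat_int)
    then show "nat \<lceil>2 powr (real N * real bsd)\<rceil> \<le> card \<Omega>"
      by (simp add: \<Omega>_def card_PiE card_Pow)
  next
    show "(\<lambda>_. False, False) = (\<lambda>_. False, False)" by (rule refl)
  next
    fix a a'
    assume a: "a \<in> \<Omega>" "a' \<in> \<Omega>"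
      and eq: "\<And>i. i < N \<Longrightarrow>
dest_out n bsd brd (\<lambda>l. l \<in> a i) (fst (\<lambda>_. False, False)) (snd (\<lambda>_. False, False))
         = dest_out n bsd brd (\<lambda>l. l \<in> a' i) (fst (\<lambda>_. False, False)) (snd (\<lambda>_. False, False))"
    show "a = a'"
    proof (rule PiE_ext)
      show "a \<in> PiE {..<N} (\<lambda>_. Pow {..<bsd})" "a' \<in> PiE {..<N} (\<lambda>_. Pow {..<bsd})"
        using a by (simp_all add: \<Omega>_def)
      then have sub: "a i \<subseteq> {..<bsd}" "a' i \<subseteq> {..<bsd}" if "i \<in> {..<N}" for i
        using that by (metis PiE_mem Pow_iff)+
      fix i assume i: "i \<in> {..<N}"
      have "l \<in> a i \<longleftrightarrow> l \<in> a' i" if "l < bsd" for l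
        using fun_cong[OF eq[of i], of "n - bsd + l"] i shiftv_nth[OF n that]
        by (simp add: dest_out_def)
      then show "a i = a' i" using sub[OF i] by blast
    qed
  qed
qed

lemma relayed_rate_achievable:
  assumes "bsd < bsr" "bsd < brd" "0 \<le> R" "R < cap_formula bsr bsd brd"
  shows "hd_achievable bsr bsd brd R"
proof -
  have "R - real bsd < (SUP \<gamma>\<in>{0..1}. min (top_entropy (2 ^ (brd - bsd)) \<gamma>) (\<gamma> * real (bsr - bsd)))"
    using assms(4) unfolding cap_formula_eq[OF assms(1,2)] by linarith
  from assms(1,2) this show ?thesis
  proof (rule exists_code_of_rate)
    fix B k and \<C> :: "(nat \<Rightarrow> nat set) set"
    assume code: "0 < B" "\<C> \<subseteq> PiE {..<B} (\<lambda>_. Pow {..<brd - bsd})"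
        "\<And>c. c \<in> \<C> \<Longrightarrow> card {j. j < B \<and> c j = {}} = k"
        "card \<C> \<le> 2 ^ (k * (bsr - bsd))" "0 < card \<C>"
      and rate: "real B * (R - real bsd) < log 2 (real (card \<C>))"
    obtain c0 where c0: "c0 \<in> \<C>" using code(5) by (metis card.empty equals0I less_irrefl)
    \<comment> \<open>Bits per slot conveyed by the relay's code words.\<close>
    define \<omega> where "\<omega> = log 2 (real (card \<C>)) / real B"
    have w: "log 2 (real (card \<C>)) = real B * \<omega>" "R - real bsd < \<omega>" "0 \<le> \<omega>"
      using rate code(1,5) by (simp_all add: \<omega>_def field_simps)
    \<comment> \<open>From this length on, the slack between \<open>bsd + \<omega>\<close> and
      \<open>R\<close> pays for the at most \<open>2 * B\<close> slots of the first and the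
      incomplete last block, and for one more bit that absorbs the ceiling.\<close>
    define K where "K = nat \<lceil>(1 + 2 * real B * \<omega>) / (\<omega> - (R - real bsd))\<rceil>"
    show ?thesis
    proof (rule hd_achievableI[where K = K])
      fix N assume N: "K \<le> N"
      define b where "b = N div B"
      define M where "M = nat \<lceil>2 powr (real N * R)\<rceil>"
      have "(1 + 2 * real B * \<omega>) / (\<omega> - (R - real bsd)) \<le> real N"
        using N unfolding K_def by linarith
      then have N': "1 + 2 * real B * \<omega> \<le> real N * (\<omega> - (R - real bsd))"
        using w(2) by (simp add: divide_le_eq)
      have "N = B * b + N mod B" by (simp add: b_def)
      moreover have "N mod B < B" using code(1) by simp
      ultimately have "real N \<le> real B * real b + real B"
        by (metis add_left_mono less_imp_le of_nat_add of_nat_le_iff of_nat_mult)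
      moreover have "real B * real b - real B \<le> real B * real (b - 1)"
        by (cases b) (auto simp: algebra_simps)
      ultimately have "real N - 2 * real B \<le> real B * real (b - 1)" by linarith
      then have "(real N - 2 * real B) * \<omega> \<le> real B * real (b - 1) * \<omega>"
        using w(3) by (rule mult_right_mono)
      then have expo: "real N * R + 1 \<le> real bsd * real N + log 2 (real (card \<C>)) * real (b - 1)"
        using N' unfolding w(1) by (simp add: algebra_simps)
      have "0 \<le> 2 powr (real N * R)" by simp
      then have "real M \<le> 2 powr (real N * R) + 1" unfolding M_def by linarith
      \<comment> \<open>As \<open>R\<close> is nonnegative, rounding up at most doubles the number
        of messages: this is the extra bit in \<open>expo\<close>.\<close>
      also have "1 \<le> 2 powr (real N * R)" using assms(3) by (intro ge_one_powr_ge_zero) auto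
      also have "2 powr (real N * R) + 2 powr (real N * R) = 2 powr (real N * R + 1)"
        by (simp add: powr_add)
      also have "\<dots> \<le> 2 powr (real bsd * real N + log 2 (real (card \<C>)) * real (b - 1))"
        using expo by (rule powr_mono) simp
      also have "\<dots> = (2 powr real bsd) powr real N * (2 powr log 2 (real (card \<C>))) powr real (b - 1)"
        by (simp only: powr_add powr_powr)
      also have "\<dots> = real ((2 ^ bsd) ^ N * card \<C> ^ (b - 1))"
        using code(5) by (simp add: powr_realpow)
      finally have "M \<le> (2 ^ bsd) ^ N * card \<C> ^ (b - 1)" by (simp only: of_nat_le_iff)
      then show "\<exists>enc rel dec. (\<forall>m. length (enc m) = N) \<and>
       err_prob (max bsr (max bsd brd)) bsr bsd brd (nat \<lceil>2 powr (real N * R)\<rceil>) enc rel dec = 0"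
        unfolding M_def[symmetric]
        by (intro block_markov_scheme[OF assms(1,2) code(2-4) c0 code(1)]) (simp_all add: b_def)
    qed
  qed
qed

theorem theorem2:
  fixes bsr bsd brd :: nat
  shows "hd_capacity bsr bsd brd = cap_formula bsr bsd brd"
proof -
  let ?A = "{R. 0 \<le> R \<and> hd_achievable bsr bsd brd R}" and ?C = "cap_formula bsr bsd brd"
  have direct: "real bsd \<in> ?A" using direct_link_achievable by simp
  have ub: "R \<le> ?C" if "R \<in> ?A" for R using that achievable_le_cap_formula by simp
  have "Sup ?A = ?C"
  proof (rule cSup_eq_non_empty)
    show "?A \<noteq> {}" using direct by blast
    show "R \<le> ?C" if "R \<in> ?A" for R using ub that .
    fix y assume y: "\<And>R. R \<in> ?A \<Longrightarrow> R \<le> y"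
    show "?C \<le> y"
    proof (cases "bsd < bsr \<and> bsd < brd")
      case False
      then show ?thesis using y[OF direct] by (auto simp: cap_formula_def)
    next
      case True
      \<comment> \<open>Rates strictly below the formula suffice: nonnegative ones are achievable,
        and negative ones lie below the direct rate \<open>bsd\<close>.\<close>
      show ?thesis
      proof (rule dense_le)
        fix R assume "R < ?C"
        show "R \<le> y"
        proof (cases "0 \<le> R")
          case True
          then show ?thesis
            using y relayed_rate_achievable \<open>bsd < bsr \<and> bsd < brd\<close> \<open>R < ?C\<close> by simp
        next
          case False
          then show ?thesis using y[OF direct] by simp
        qed
      qed
    qed
  qed
  then show ?thesis by (simp add: hd_capacity_def)
qed

end
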